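(* Let $(X,\mathscr A,\mu)$ be a $\sigma$-finite measure space and let $\phi$ be a nonsingular transformation of $X$. Suppose that the composition operator $C_\phi$ is densely defined and $C_\phi=U|C_\phi|$ is its polar decomposition. Then: (i) $|C_\phi|=M_{\mathsf h_\phi^{1/2}}$; (ii) the initial space of $U$ is given by $\overline{\mathcal R(|C_\phi|)}=\{\mathsf h_\phi^{1/2}f\colon f\in L^2(\mathsf h_\phi\,d\mu)\}$; (iii) the final space of $U$ is given by $\overline{\mathcal R(C_\phi)}=\{f\circ\phi\colon f\in L^2(\mathsf h_\phi\,d\mu)\}$; (iv) the partial isometry $U$ is given by $$Ug=\frac{g\circ\phi}{(\mathsf h_\phi\circ\phi)^{1/2}},\quad g\in L^2(\mu);$$ (v) the adjoint $U^*$ of $U$ is given by $$U^*g=\mathsf h_\phi^{1/2}\cdot V^{-1}Pg,\quad g\in L^2(\mu),$$ where $V\colon L^2(\mathsf h_\phi\,d\mu)\to\overline{\mathcal R(C_\phi)}$ is a unitary operator defined by $Vf=f\circ\phi$ for $f\in L^2(\mathsf h_\phi\,d\mu)$ and $P$ is the orthogonal projection of $L^2(\mu)$ onto $\overline{\mathcal R(C_\phi)}$.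
   Context: $L^2(\mu)$ is the complex Hilbert space of square integrable complex functions on $X$. A transformation $\phi\colon X\to X$ is nonsingular if $\phi^{-1}(\Delta)\in\mathscr A$ for all $\Delta\in\mathscr A$ and the measure $\mu\circ\phi^{-1}$, $\Delta\mapsto\mu(\phi^{-1}(\Delta))$, is absolutely continuous with respect to $\mu$. The composition operator $C_\phi$ in $L^2(\mu)$ is given by $\mathcal D(C_\phi)=\{f\in L^2(\mu)\colon f\circ\phi\in L^2(\mu)\}$, $C_\phi f=f\circ\phi$ (possibly unbounded; it is always a closed operator). $\mathsf h_\phi\colon X\to[0,\infty]$ is the ($\mu$-a.e. unique) $\mathscr A$-measurable function with $\mu(\phi^{-1}(\Delta))=\int_\Delta\mathsf h_\phi\,d\mu$ for all $\Delta\in\mathscr A$; one has $\mathsf h_\phi\circ\phi>0$ a.e. $[\mu]$, and $\mathsf h_\phi<\infty$ a.e. $[\mu]$ when $C_\phi$ is densely defined. $\mathcal R(A)$ denotes the range of an operator $A$. For an $\mathscr A$-measurable $u\colon X\to\mathbb C$, $M_u$ is the operator of multiplication by $u$ in $L^2(\mu)$ with domain $\{f\in L^2(\mu)\colon uf\in L^2(\mu)\}$. The polar decomposition of a closed densely defined operator $A$ is $A=U|A|$, where $|A|=(A^*A)^{1/2}$ and $U$ is the unique partial isometry with $A=U|A|$ and $\ker U=\ker A$. *)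

theory Defs
  imports "HOL-Analysis.Analysis"
begin

section \<open>Operators between complex inner product spaces\<close>

text \<open>The space $L^2(\mu)$ depends on the measure, a term, so inner product spaces are
  given by explicit carriers rather than by a type class.\<close>

record 'v cip_space =
  vecs :: "'v set"
  vzero :: 'v
  vadd :: "'v \<Rightarrow> 'v \<Rightarrow> 'v"
  vscale :: "complex \<Rightarrow> 'v \<Rightarrow> 'v"
  cinner :: "'v \<Rightarrow> 'v \<Rightarrow> complex"  \<comment> \<open>linear in the first argument\<close>

definition vnorm :: "'v cip_space \<Rightarrow> 'v \<Rightarrow> real" where
  "vnorm H f = sqrt (Re (cinner H f f))"

definition vdist :: "'v cip_space \<Rightarrow> 'v \<Rightarrow> 'v \<Rightarrow> real" where
  "vdist H f g = vnorm H (vadd H f (vscale H (- 1) g))"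

definition vclosure :: "'v cip_space \<Rightarrow> 'v set \<Rightarrow> 'v set" where
  "vclosure H S = {f \<in> vecs H. \<forall>e>0. \<exists>g\<in>S. vdist H f g < e}"

definition orth_compl :: "'v cip_space \<Rightarrow> 'v set \<Rightarrow> 'v set" where
  "orth_compl H S = {f \<in> vecs H. \<forall>g\<in>S. cinner H f g = 0}"

text \<open>A possibly unbounded operator is identified with its graph. Thus its domain, range and
  inverse are \<^const>\<open>Domain\<close>, \<^const>\<open>Range\<close> and \<^const>\<open>converse\<close>. Beware of the order in
  compositions: the operator product $BA$ (first $A$, then $B$) is \<^term>\<open>A O B\<close>.\<close>

definition linear_op :: "'v cip_space \<Rightarrow> 'w cip_space \<Rightarrow> ('v \<times> 'w) set \<Rightarrow> bool" where
  "linear_op H K A \<longleftrightarrow>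
     A \<subseteq> vecs H \<times> vecs K \<and> single_valued A \<and> (vzero H, vzero K) \<in> A \<and>
     (\<forall>f g f' g'. (f, g) \<in> A \<longrightarrow> (f', g') \<in> A \<longrightarrow> (vadd H f f', vadd K g g') \<in> A) \<and>
     (\<forall>c f g. (f, g) \<in> A \<longrightarrow> (vscale H c f, vscale K c g) \<in> A)"

definition densely_defined :: "'v cip_space \<Rightarrow> ('v \<times> 'w) set \<Rightarrow> bool" where
  "densely_defined H A \<longleftrightarrow> vclosure H (Domain A) = vecs H"

definition op_kernel :: "'w cip_space \<Rightarrow> ('v \<times> 'w) set \<Rightarrow> 'v set" where
  "op_kernel K A = {f. (f, vzero K) \<in> A}"

definition adjoint_op :: "'v cip_space \<Rightarrow> 'w cip_space \<Rightarrow> ('v \<times> 'w) set \<Rightarrow> ('w \<times> 'v) set" where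
  "adjoint_op H K A =
     {(g, k). g \<in> vecs K \<and> k \<in> vecs H \<and> (\<forall>(f, Af) \<in> A. cinner K Af g = cinner H f k)}"

definition selfadjoint_op :: "'v cip_space \<Rightarrow> ('v \<times> 'v) set \<Rightarrow> bool" where
  "selfadjoint_op H A \<longleftrightarrow> linear_op H H A \<and> densely_defined H A \<and> adjoint_op H H A = A"

definition positive_op :: "'v cip_space \<Rightarrow> ('v \<times> 'v) set \<Rightarrow> bool" where
  "positive_op H A \<longleftrightarrow> (\<forall>(f, Af) \<in> A. cinner H Af f \<in> \<real>\<^sub>\<ge>\<^sub>0)"

text \<open>The square root of a positive selfadjoint operator is its unique positive selfadjoint
  square root; here \<^term>\<open>A O adjoint_op H K A\<close> is $A^*A$.\<close>

definition sqrt_op :: "'v cip_space \<Rightarrow> ('v \<times> 'v) set \<Rightarrow> ('v \<times> 'v) set" where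
  "sqrt_op H A = (THE B. selfadjoint_op H B \<and> positive_op H B \<and> B O B = A)"

definition abs_op :: "'v cip_space \<Rightarrow> 'w cip_space \<Rightarrow> ('v \<times> 'w) set \<Rightarrow> ('v \<times> 'v) set" where
  "abs_op H K A = sqrt_op H (A O adjoint_op H K A)"

definition bounded_op :: "'v cip_space \<Rightarrow> 'w cip_space \<Rightarrow> ('v \<times> 'w) set \<Rightarrow> bool" where
  "bounded_op H K A \<longleftrightarrow>
     linear_op H K A \<and> Domain A = vecs H \<and> (\<exists>c. \<forall>(f, g) \<in> A. vnorm K g \<le> c * vnorm H f)"

definition initial_space :: "'v cip_space \<Rightarrow> 'w cip_space \<Rightarrow> ('v \<times> 'w) set \<Rightarrow> 'v set" where
  "initial_space H K U = orth_compl H (op_kernel K U)"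

definition final_space :: "('v \<times> 'w) set \<Rightarrow> 'w set" where
  "final_space U = Range U"

definition partial_isometry :: "'v cip_space \<Rightarrow> 'w cip_space \<Rightarrow> ('v \<times> 'w) set \<Rightarrow> bool" where
  "partial_isometry H K U \<longleftrightarrow>
     bounded_op H K U \<and> (\<forall>(f, g) \<in> U. f \<in> initial_space H K U \<longrightarrow> vnorm K g = vnorm H f)"

definition polar_decomposition ::
  "'v cip_space \<Rightarrow> 'w cip_space \<Rightarrow> ('v \<times> 'w) set \<Rightarrow> ('v \<times> 'w) set \<Rightarrow> bool" where
  "polar_decomposition H K A U \<longleftrightarrow>
     partial_isometry H K U \<and> A = abs_op H K A O U \<and> op_kernel K U = op_kernel K A"

definition unitary_op :: "'v cip_space \<Rightarrow> 'w cip_space \<Rightarrow> ('v \<times> 'w) set \<Rightarrow> bool" where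
  "unitary_op H K V \<longleftrightarrow>
     linear_op H K V \<and> Domain V = vecs H \<and> Range V = vecs K \<and>
     (\<forall>(f, g) \<in> V. \<forall>(f', g') \<in> V. cinner K g g' = cinner H f f')"

definition orth_projection :: "'v cip_space \<Rightarrow> 'v set \<Rightarrow> ('v \<times> 'v) set" where
  "orth_projection H S =
     {(f, p). f \<in> vecs H \<and> p \<in> S \<and> vadd H f (vscale H (- 1) p) \<in> orth_compl H S}"


section \<open>The space $L^2(\mu)$\<close>

definition square_integrable :: "'a measure \<Rightarrow> ('a \<Rightarrow> complex) \<Rightarrow> bool" where
  "square_integrable M f \<longleftrightarrow> f \<in> borel_measurable M \<and> integrable M (\<lambda>x. (cmod (f x))\<^sup>2)"

definition ae_class :: "'a measure \<Rightarrow> ('a \<Rightarrow> complex) \<Rightarrow> ('a \<Rightarrow> complex) set" where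
  "ae_class M f = {g \<in> borel_measurable M. AE x in M. g x = f x}"

definition rep :: "('a \<Rightarrow> complex) set \<Rightarrow> 'a \<Rightarrow> complex" where
  "rep F = (SOME f. f \<in> F)"

definition L2 :: "'a measure \<Rightarrow> ('a \<Rightarrow> complex) set cip_space" where
  "L2 M =
    \<lparr> vecs = ae_class M ` {f. square_integrable M f},
      vzero = ae_class M (\<lambda>x. 0),
      vadd = (\<lambda>F G. ae_class M (\<lambda>x. rep F x + rep G x)),
      vscale = (\<lambda>c F. ae_class M (\<lambda>x. c * rep F x)),
      cinner = (\<lambda>F G. LINT x|M. rep F x * cnj (rep G x)) \<rparr>"


section \<open>Multiplication and composition operators\<close>

definition mult_op :: "'a measure \<Rightarrow> ('a \<Rightarrow> complex) \<Rightarrow>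
    (('a \<Rightarrow> complex) set \<times> ('a \<Rightarrow> complex) set) set" where
  "mult_op M u = {(ae_class M f, ae_class M (\<lambda>x. u x * f x)) | f.
     square_integrable M f \<and> square_integrable M (\<lambda>x. u x * f x)}"

definition nonsingular :: "'a measure \<Rightarrow> ('a \<Rightarrow> 'a) \<Rightarrow> bool" where
  "nonsingular M \<phi> \<longleftrightarrow> \<phi> \<in> measurable M M \<and> absolutely_continuous M (distr M M \<phi>)"

definition comp_op :: "'a measure \<Rightarrow> ('a \<Rightarrow> 'a) \<Rightarrow>
    (('a \<Rightarrow> complex) set \<times> ('a \<Rightarrow> complex) set) set" where
  "comp_op M \<phi> = {(ae_class M f, ae_class M (f \<circ> \<phi>)) | f.
     square_integrable M f \<and> square_integrable M (f \<circ> \<phi>)}"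

definition h_of :: "'a measure \<Rightarrow> ('a \<Rightarrow> 'a) \<Rightarrow> 'a \<Rightarrow> ennreal" where
  "h_of M \<phi> = RN_deriv M (distr M M \<phi>)"

text \<open>The function $\mathsf h_\phi^{1/2}$. The value of \<^const>\<open>enn2real\<close> at infinity is $0$, which
  is harmless: when $C_\phi$ is densely defined, $\mathsf h_\phi$ is finite almost everywhere.\<close>

definition sqrt_h :: "'a measure \<Rightarrow> ('a \<Rightarrow> 'a) \<Rightarrow> 'a \<Rightarrow> complex" where
  "sqrt_h M \<phi> x = complex_of_real (sqrt (enn2real (h_of M \<phi> x)))"

text \<open>The measure $\mathsf h_\phi\,d\mu$ and the operator $V f = f \circ \phi$ from
  $L^2(\mathsf h_\phi\,d\mu)$ into $L^2(\mu)$.\<close>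

definition h_measure :: "'a measure \<Rightarrow> ('a \<Rightarrow> 'a) \<Rightarrow> 'a measure" where
  "h_measure M \<phi> = density M (h_of M \<phi>)"

definition comp_unitary :: "'a measure \<Rightarrow> ('a \<Rightarrow> 'a) \<Rightarrow>
    (('a \<Rightarrow> complex) set \<times> ('a \<Rightarrow> complex) set) set" where
  "comp_unitary M \<phi> = {(ae_class (h_measure M \<phi>) f, ae_class M (f \<circ> \<phi>)) | f.
     square_integrable (h_measure M \<phi>) f}"

end

theory Submission
  imports Defs
begin

text \<open>Since $\mu \circ \phi^{-1} = \mathsf h_\phi\,d\mu$, the map $f \mapsto f \circ \phi$ is isometric from
  $L^2(\mathsf h_\phi\,d\mu)$ into $L^2(\mu)$, and testing against truncated functions yields
  $C_\phi^* C_\phi = M_{\mathsf h_\phi}$.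

  The positive selfadjoint square root $B$ of a multiplication operator $M_{r^2}$ is $M_r$. If $f$ lives
  where $s - \delta \le r \le s$, positivity of $B$ gives $s\|(B - s)f\| \le \|(r^2 - s^2)f\|$, hence
  $\|(B - r)f\| = O(\delta)\|f\|$. Cutting $\{r \le c\}$ into $n$ slices of width $\delta = c/n$ loses
  only a factor $\sqrt n$, because the pieces of $f$ are orthogonal; so $B = M_r$ on functions supported
  in $\{r \le c\}$. By symmetry $B \subseteq M_r$, and both operators are selfadjoint.

  The formula for $U$ follows from $C_\phi = U|C_\phi|$ on the range of $|C_\phi|$ by continuity. The
  projection onto the closed range of $C_\phi$ is obtained from the Radon-Nikodym derivative of
  $(g\,d\mu) \circ \phi^{-1}$ for $g \ge 0$, so completeness of $L^2$ is never used.\<close>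

section \<open>Square integrable functions and their classes\<close>

text \<open>\<open>sqrt_op\<close> is a definite description, so the modulus of C is identified only
  after every competing square root B has been excluded. Such a B is abstract: nothing says that it
  commutes with cutting off by indicators. Hence the errors (B - r) f_i on different slices cannot
  be taken to be orthogonal, although the pieces f_i are; only the shrinking width of the slices
  makes up for that loss. Estimates are stated for squared norms with a free weight t. The weighted
  forms replace the triangle and the Cauchy-Schwarz inequality and let each use choose its own
  balance. The function w obtained from the Radon-Nikodym derivative is V^* g, and w \<circ> \<phi>
  is the conditional expectation of g given the preimages of measurable sets under \<phi>. Since V
  is isometric, V^* = V^{-1} P, which links the projection with the adjoint of U. A recurring
  obstacle is that L^2(h d\<mu>) need not be contained in L^2(\<mu>), so its elements must be cut
  down to {r \<ge> 1/n} before C can be applied to them.\<close>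

definition sqnorm :: "'a measure \<Rightarrow> ('a \<Rightarrow> complex) \<Rightarrow> real" where
  "sqnorm M f = (LINT x|M. (cmod (f x))\<^sup>2)"

lemma square_integrable_measurable [measurable_dest]:
  "square_integrable M f \<Longrightarrow> f \<in> borel_measurable M"
  by (simp add: square_integrable_def)

lemma square_integrable_integrable:
  "square_integrable M f \<Longrightarrow> integrable M (\<lambda>x. (cmod (f x))\<^sup>2)"
  by (simp add: square_integrable_def)

lemma sqnorm_nonneg [simp]: "0 \<le> sqnorm M f"
  by (simp add: sqnorm_def)

lemma square_integrable_bound:
  assumes f: "square_integrable M f" and g [measurable]: "g \<in> borel_measurable M"
    and le: "AE x in M. cmod (g x) \<le> c * cmod (f x)"
  shows "square_integrable M g" and "sqnorm M g \<le> c\<^sup>2 * sqnorm M f"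
proof -
  note [measurable] = square_integrable_measurable[OF f]
  have int: "integrable M (\<lambda>x. c\<^sup>2 * (cmod (f x))\<^sup>2)"
    using square_integrable_integrable[OF f] by simp
  have le2: "AE x in M. (cmod (g x))\<^sup>2 \<le> c\<^sup>2 * (cmod (f x))\<^sup>2"
    using le
  proof eventually_elim
    case (elim x)
    then have "(cmod (g x))\<^sup>2 \<le> (c * cmod (f x))\<^sup>2" by (intro power_mono) auto
    then show ?case by (simp add: power_mult_distrib)
  qed
  have ig: "integrable M (\<lambda>x. (cmod (g x))\<^sup>2)"
    by (rule Bochner_Integration.integrable_bound[OF int]) (use le2 in auto)
  then show "square_integrable M g" by (simp add: square_integrable_def)
  have "sqnorm M g \<le> (LINT x|M. c\<^sup>2 * (cmod (f x))\<^sup>2)"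
    unfolding sqnorm_def by (rule integral_mono_AE[OF ig int le2])
  then show "sqnorm M g \<le> c\<^sup>2 * sqnorm M f" by (simp add: sqnorm_def)
qed

lemma square_integrable_restrict:
  assumes f: "square_integrable M f" and P [measurable]: "Measurable.pred M P"
  shows "square_integrable M (\<lambda>x. if P x then f x else 0)"
proof -
  note [measurable] = square_integrable_measurable[OF f]
  show ?thesis by (rule square_integrable_bound(1)[OF f, of _ 1]) auto
qed

lemma square_integrable_cong_AE:
  assumes f: "square_integrable M f" and g [measurable]: "g \<in> borel_measurable M"
    and eq: "AE x in M. g x = f x"
  shows "square_integrable M g"
  by (rule square_integrable_bound(1)[OF f g, of 1]) (use eq in auto)

lemma square_integrable_zero [simp]: "square_integrable M (\<lambda>x. 0)"
  by (simp add: square_integrable_def)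

lemma square_integrable_scale:
  assumes f: "square_integrable M f" shows "square_integrable M (\<lambda>x. c * f x)"
proof -
  note [measurable] = square_integrable_measurable[OF f]
  show ?thesis by (rule square_integrable_bound(1)[OF f, of _ "cmod c"]) (auto simp: norm_mult)
qed

text \<open>The slack is the square (|a| - t |b|)^2 / t. The weight t = 1 gives the usual factor 2;
  the slicing argument needs a weight that grows with the number of slices.\<close>

lemma norm_add_weighted_square:
  fixes a b :: complex
  assumes t: "0 < t"
  shows "(cmod (a + b))\<^sup>2 \<le> (1 + 1 / t) * (cmod a)\<^sup>2 + (1 + t) * (cmod b)\<^sup>2"
proof -
  have "(cmod (a + b))\<^sup>2 \<le> (cmod a + cmod b)\<^sup>2"
    by (intro power_mono norm_triangle_ineq) auto
  also have "\<dots> \<le> (cmod a + cmod b)\<^sup>2 + (cmod a - t * cmod b)\<^sup>2 / t" using t by simp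
  also have "\<dots> = (1 + 1 / t) * (cmod a)\<^sup>2 + (1 + t) * (cmod b)\<^sup>2"
    using t by (simp add: power2_eq_square field_simps)
  finally show ?thesis .
qed

lemma
  assumes f: "square_integrable M f" and g: "square_integrable M g"
  shows square_integrable_add: "square_integrable M (\<lambda>x. f x + g x)"
    and sqnorm_add_weighted:
      "0 < t \<Longrightarrow> sqnorm M (\<lambda>x. f x + g x) \<le> (1 + 1 / t) * sqnorm M f + (1 + t) * sqnorm M g"
proof -
  note [measurable] = square_integrable_measurable[OF f] square_integrable_measurable[OF g]
  note int = square_integrable_integrable[OF f] square_integrable_integrable[OF g]
  have bound: "integrable M (\<lambda>x. (1 + 1 / t) * (cmod (f x))\<^sup>2 + (1 + t) * (cmod (g x))\<^sup>2)" for t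
    using int by auto
  have ifg: "integrable M (\<lambda>x. (cmod (f x + g x))\<^sup>2)"
    by (rule Bochner_Integration.integrable_bound[OF bound[of 1]])
       (use norm_add_weighted_square[of 1] in auto)
  then show "square_integrable M (\<lambda>x. f x + g x)" by (simp add: square_integrable_def)
  assume t: "0 < t"
  have "sqnorm M (\<lambda>x. f x + g x)
      \<le> (LINT x|M. (1 + 1 / t) * (cmod (f x))\<^sup>2 + (1 + t) * (cmod (g x))\<^sup>2)"
    unfolding sqnorm_def
    by (rule integral_mono[OF ifg bound]) (rule norm_add_weighted_square[OF t])
  then show "sqnorm M (\<lambda>x. f x + g x) \<le> (1 + 1 / t) * sqnorm M f + (1 + t) * sqnorm M g"
    using int by (simp add: sqnorm_def)
qed

lemma square_integrable_diff:
  assumes "square_integrable M f" "square_integrable M g"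
  shows "square_integrable M (\<lambda>x. f x - g x)"
  using square_integrable_add[OF assms(1) square_integrable_scale[OF assms(2), of "-1"]] by simp

lemma sqnorm_diff_le:
  assumes "square_integrable M f" "square_integrable M g"
  shows "sqnorm M (\<lambda>x. f x - g x) \<le> 2 * sqnorm M f + 2 * sqnorm M g"
  using sqnorm_add_weighted[OF assms(1) square_integrable_scale[OF assms(2), of "-1"], of 1]
  by (simp add: sqnorm_def)

text \<open>Serves as Cauchy-Schwarz under the integral sign: the optimisation over t is left to the
  place of use, so one never divides by a norm that may vanish.\<close>

lemma weighted_mean_inequality:
  fixes a b :: real
  assumes t: "0 < t"
  shows "a * b \<le> (a\<^sup>2 / t + t * b\<^sup>2) / 2"
proof -
  have "a * b \<le> a * b + (a - t * b)\<^sup>2 / (2 * t)" using t by simp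
  also have "\<dots> = (a\<^sup>2 / t + t * b\<^sup>2) / 2"
    using t by (simp add: power2_eq_square field_simps)
  finally show ?thesis .
qed

lemma integrable_square_integrable_mult:
  assumes f: "square_integrable M f" and g: "square_integrable M g"
  shows "integrable M (\<lambda>x. f x * g x)"
proof -
  note [measurable] = square_integrable_measurable[OF f] square_integrable_measurable[OF g]
  \<comment> \<open>The factors \<open>/ 1\<close> and \<open>1 *\<close> stay so that the majorant
    is literally the instance t = 1 of \<open>weighted_mean_inequality\<close>.\<close>
  have "integrable M (\<lambda>x. ((cmod (f x))\<^sup>2 / 1 + 1 * (cmod (g x))\<^sup>2) / 2)"
    using square_integrable_integrable[OF f] square_integrable_integrable[OF g] by simp
  then show ?thesis
  proof (rule Bochner_Integration.integrable_bound)
    have "cmod (f x * g x) \<le> norm (((cmod (f x))\<^sup>2 / 1 + 1 * (cmod (g x))\<^sup>2) / 2)" for x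
      unfolding norm_mult real_norm_def
      by (rule order_trans[OF weighted_mean_inequality[OF zero_less_one] abs_ge_self])
    then show "AE x in M. cmod (f x * g x) \<le> norm (((cmod (f x))\<^sup>2 / 1 + 1 * (cmod (g x))\<^sup>2) / 2)"
      by blast
  qed simp
qed

lemma borel_measurable_cnj [measurable]: "cnj \<in> borel_measurable borel"
  by (intro borel_measurable_continuous_onI continuous_on_cnj continuous_on_id)

lemma square_integrable_cnj:
  "square_integrable M f \<Longrightarrow> square_integrable M (\<lambda>x. cnj (f x))"
  by (simp add: square_integrable_def measurable_compose[OF _ borel_measurable_cnj])

lemma integrable_mult_cnj:
  "square_integrable M f \<Longrightarrow> square_integrable M g \<Longrightarrow> integrable M (\<lambda>x. f x * cnj (g x))"
  by (intro integrable_square_integrable_mult square_integrable_cnj)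

lemma integral_mult_cnj_self: "(LINT x|M. f x * cnj (f x)) = complex_of_real (sqnorm M f)"
  unfolding complex_norm_square[symmetric] sqnorm_def by (rule integral_complex_of_real)

lemma sqnorm_eq_0_iff:
  assumes "square_integrable M f"
  shows "sqnorm M f = 0 \<longleftrightarrow> (AE x in M. f x = 0)"
  using integral_nonneg_eq_0_iff_AE[OF square_integrable_integrable[OF assms]]
  by (simp add: sqnorm_def)

lemma integral_mult_cnj_le:
  assumes f: "square_integrable M f" and g: "square_integrable M g" and t: "0 < t"
  shows "cmod (LINT x|M. f x * cnj (g x)) \<le> (sqnorm M f / t + t * sqnorm M g) / 2"
proof -
  note [measurable] = square_integrable_measurable[OF f] square_integrable_measurable[OF g]
  note int = square_integrable_integrable[OF f] square_integrable_integrable[OF g]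
  have "cmod (LINT x|M. f x * cnj (g x)) \<le> (LINT x|M. cmod (f x * cnj (g x)))"
    by (rule integral_norm_bound)
  also have "\<dots> \<le> (LINT x|M. ((cmod (f x))\<^sup>2 / t + t * (cmod (g x))\<^sup>2) / 2)"
  proof (rule integral_mono)
    show "integrable M (\<lambda>x. cmod (f x * cnj (g x)))"
      using integrable_mult_cnj[OF f g] by auto
    show "integrable M (\<lambda>x. ((cmod (f x))\<^sup>2 / t + t * (cmod (g x))\<^sup>2) / 2)"
      using int by auto
    fix x
    show "cmod (f x * cnj (g x)) \<le> ((cmod (f x))\<^sup>2 / t + t * (cmod (g x))\<^sup>2) / 2"
      using weighted_mean_inequality[OF t, of "cmod (f x)" "cmod (g x)"] by (simp add: norm_mult)
  qed
  also have "\<dots> = (sqnorm M f / t + t * sqnorm M g) / 2"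
    using int by (simp add: sqnorm_def)
  finally show ?thesis .
qed

text \<open>Dominated convergence with majorant |f|^2. The cutoffs only have to capture the points
  where f is nonzero, which allows them to miss the zeros of a weight.\<close>

lemma sqnorm_truncation_tendsto_0:
  assumes f: "square_integrable M f" and P [measurable]: "\<And>n. Measurable.pred M (P n)"
    and ev: "AE x in M. f x \<noteq> 0 \<longrightarrow> eventually (\<lambda>n. P n x) sequentially"
  shows "(\<lambda>n. sqnorm M (\<lambda>x. f x - (if P n x then f x else 0))) \<longlonglongrightarrow> 0"
proof -
  note [measurable] = square_integrable_measurable[OF f]
  have "(\<lambda>n. LINT x|M. (cmod (f x - (if P n x then f x else 0)))\<^sup>2) \<longlonglongrightarrow> (LINT x|M. 0)"
  proof (rule integral_dominated_convergence[OF _ _ square_integrable_integrable[OF f]])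
    show "AE x in M. (\<lambda>n. (cmod (f x - (if P n x then f x else 0)))\<^sup>2) \<longlonglongrightarrow> 0"
      using ev
    proof eventually_elim
      case (elim x)
      show ?case
      proof (rule tendsto_eventually, cases "f x = 0")
        case False
        with elim have "eventually (\<lambda>n. P n x) sequentially" by simp
        then show "eventually (\<lambda>n. (cmod (f x - (if P n x then f x else 0)))\<^sup>2 = 0) sequentially"
          by eventually_elim simp
      qed simp
    qed
  qed auto
  then show ?thesis by (simp add: sqnorm_def)
qed

section \<open>Classes modulo null sets and the operations of \<open>L2\<close>\<close>

lemma ae_class_eq_iff:
  assumes "f \<in> borel_measurable M"
  shows "ae_class M f = ae_class M g \<longleftrightarrow> (AE x in M. f x = g x)"
proof
  assume "ae_class M f = ae_class M g"
  moreover have "f \<in> ae_class M f" using assms by (simp add: ae_class_def)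
  ultimately show "AE x in M. f x = g x" by (auto simp: ae_class_def)
next
  assume "AE x in M. f x = g x"
  then show "ae_class M f = ae_class M g"
    by (auto simp: ae_class_def elim: eventually_elim2)
qed

lemma ae_class_cong:
  "AE x in M. f x = g x \<Longrightarrow> ae_class M f = ae_class M g"
  by (auto simp: ae_class_def elim: eventually_elim2)

lemma ae_class_iff: "g \<in> ae_class M f \<longleftrightarrow> g \<in> borel_measurable M \<and> (AE x in M. g x = f x)"
  by (simp add: ae_class_def)

lemma
  assumes "f \<in> borel_measurable M"
  shows rep_measurable: "rep (ae_class M f) \<in> borel_measurable M"
    and rep_AE: "AE x in M. rep (ae_class M f) x = f x"
proof -
  have "rep (ae_class M f) \<in> ae_class M f"
    unfolding rep_def by (rule someI[of _ f]) (simp add: ae_class_iff assms)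
  then show "rep (ae_class M f) \<in> borel_measurable M" "AE x in M. rep (ae_class M f) x = f x"
    unfolding ae_class_iff by blast+
qed

lemma vecs_L2: "vecs (L2 M) = ae_class M ` {f. square_integrable M f}"
  by (simp add: L2_def)

lemma ae_class_in_vecs [simp]: "square_integrable M f \<Longrightarrow> ae_class M f \<in> vecs (L2 M)"
  by (simp add: vecs_L2)

lemma vecs_L2E:
  assumes "F \<in> vecs (L2 M)" obtains f where "square_integrable M f" "F = ae_class M f"
  using assms by (auto simp: vecs_L2)

lemma vzero_L2: "vzero (L2 M) = ae_class M (\<lambda>x. 0)"
  by (simp add: L2_def)

lemma vadd_L2:
  assumes "f \<in> borel_measurable M" "g \<in> borel_measurable M"
  shows "vadd (L2 M) (ae_class M f) (ae_class M g) = ae_class M (\<lambda>x. f x + g x)"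
  using rep_AE[OF assms(1)] rep_AE[OF assms(2)]
  by (auto simp: L2_def intro!: ae_class_cong)

lemma vscale_L2:
  assumes "f \<in> borel_measurable M"
  shows "vscale (L2 M) c (ae_class M f) = ae_class M (\<lambda>x. c * f x)"
  using rep_AE[OF assms(1)] by (auto simp: L2_def intro!: ae_class_cong)

lemma vdiff_L2:
  assumes [measurable]: "f \<in> borel_measurable M" "g \<in> borel_measurable M"
  shows "vadd (L2 M) (ae_class M f) (vscale (L2 M) (- 1) (ae_class M g)) = ae_class M (\<lambda>x. f x - g x)"
  by (simp add: vscale_L2 vadd_L2)

lemma cinner_L2:
  assumes [measurable]: "f \<in> borel_measurable M" "g \<in> borel_measurable M"
  shows "cinner (L2 M) (ae_class M f) (ae_class M g) = (LINT x|M. f x * cnj (g x))"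
proof -
  note [measurable] = rep_measurable[OF assms(1)] rep_measurable[OF assms(2)]
  have "(LINT x|M. rep (ae_class M f) x * cnj (rep (ae_class M g) x)) = (LINT x|M. f x * cnj (g x))"
    by (rule integral_cong_AE) (use rep_AE[OF assms(1)] rep_AE[OF assms(2)] in auto)
  then show ?thesis by (simp add: L2_def)
qed

lemma vnorm_L2:
  assumes "f \<in> borel_measurable M"
  shows "vnorm (L2 M) (ae_class M f) = sqrt (sqnorm M f)"
  by (simp add: vnorm_def cinner_L2[OF assms assms] integral_mult_cnj_self)

lemma vdist_L2:
  assumes [measurable]: "f \<in> borel_measurable M" "g \<in> borel_measurable M"
  shows "vdist (L2 M) (ae_class M f) (ae_class M g) = sqrt (sqnorm M (\<lambda>x. f x - g x))"
  by (simp add: vdist_def vdiff_L2[OF assms] vnorm_L2)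

lemma vclosure_L2I:
  assumes f: "square_integrable M f"
    and s: "\<And>n. ae_class M (s n) \<in> S" "\<And>n. s n \<in> borel_measurable M"
    and lim: "(\<lambda>n. sqnorm M (\<lambda>x. f x - s n x)) \<longlonglongrightarrow> 0"
  shows "ae_class M f \<in> vclosure (L2 M) S"
  unfolding vclosure_def
proof (intro CollectI conjI allI impI)
  show "ae_class M f \<in> vecs (L2 M)" using f by simp
  fix e :: real assume e: "0 < e"
  have "eventually (\<lambda>n. sqnorm M (\<lambda>x. f x - s n x) < e\<^sup>2) sequentially"
    by (rule order_tendstoD(2)[OF lim]) (use e in simp)
  then obtain n where "sqnorm M (\<lambda>x. f x - s n x) < e\<^sup>2" by (auto simp: eventually_sequentially)
  then have "vdist (L2 M) (ae_class M f) (ae_class M (s n)) < e"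
    using e s(2) f by (simp add: vdist_L2 square_integrable_measurable real_less_lsqrt)
  with s(1) show "\<exists>g\<in>S. vdist (L2 M) (ae_class M f) g < e" by blast
qed

lemma vclosure_L2E:
  assumes "F \<in> vclosure (L2 M) S" and S: "S \<subseteq> vecs (L2 M)"
  obtains f where "square_integrable M f" "F = ae_class M f"
    "\<forall>e>0. \<exists>g. square_integrable M g \<and> ae_class M g \<in> S \<and> sqnorm M (\<lambda>x. f x - g x) < e"
proof -
  from assms(1) have F: "F \<in> vecs (L2 M)" and cl: "\<And>e. 0 < e \<Longrightarrow> \<exists>G\<in>S. vdist (L2 M) F G < e"
    by (auto simp: vclosure_def)
  from F obtain f where f: "square_integrable M f" "F = ae_class M f" by (rule vecs_L2E)
  moreover have "\<exists>g. square_integrable M g \<and> ae_class M g \<in> S \<and> sqnorm M (\<lambda>x. f x - g x) < e"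
    if "0 < e" for e
  proof -
    from cl[of "sqrt e"] that obtain G where G: "G \<in> S" "vdist (L2 M) F G < sqrt e" by auto
    from S G(1) have "G \<in> vecs (L2 M)" by auto
    then obtain g where g: "square_integrable M g" "G = ae_class M g" by (rule vecs_L2E)
    with f G show ?thesis by (auto simp: vdist_L2 square_integrable_measurable)
  qed
  ultimately show thesis using that by blast
qed

text \<open>Orthogonality survives limits: for g in S near f, the inner product of f with k equals
  that of f - g with k, which is small.\<close>

lemma vclosure_subset_orth_compl:
  assumes S: "S \<subseteq> orth_compl (L2 M) T" and T: "T \<subseteq> vecs (L2 M)"
  shows "vclosure (L2 M) S \<subseteq> orth_compl (L2 M) T"
proof
  fix F assume "F \<in> vclosure (L2 M) S"
  moreover have SV: "S \<subseteq> vecs (L2 M)" using S by (auto simp: orth_compl_def)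
  ultimately obtain f where f: "square_integrable M f" "F = ae_class M f"
    and cl: "\<forall>e>0. \<exists>g. square_integrable M g \<and> ae_class M g \<in> S \<and> sqnorm M (\<lambda>x. f x - g x) < e"
    by (rule vclosure_L2E)
  have "cinner (L2 M) F K = 0" if K: "K \<in> T" for K
  proof -
    from T K obtain k where k: "square_integrable M k" "K = ae_class M k" by (auto elim: vecs_L2E)
    \<comment> \<open>If the squared distance of f and g is below t^2, the weighted bound is at most
      (t^2 / t + t ||k||^2) / 2 = t C. The summand 1 also keeps C positive, so that t = e / C can be
      taken at the end.\<close>
    define C where "C = (1 + sqnorm M k) / 2"
    have C: "0 < C" by (simp add: C_def add_pos_nonneg)
    have small: "cmod (LINT x|M. f x * cnj (k x)) \<le> t * C" if t: "0 < t" for t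
    proof -
      from cl[rule_format, of "t * t"] t obtain g where g: "square_integrable M g" "ae_class M g \<in> S"
        "sqnorm M (\<lambda>x. f x - g x) < t * t" by auto
      have "cinner (L2 M) (ae_class M g) K = 0"
        using S g(2) K by (auto simp: orth_compl_def)
      then have "(LINT x|M. g x * cnj (k x)) = 0"
        using g(1) k by (simp add: cinner_L2 square_integrable_measurable)
      then have "(LINT x|M. f x * cnj (k x)) = (LINT x|M. (f x - g x) * cnj (k x))"
        using integrable_mult_cnj[OF f(1) k(1)] integrable_mult_cnj[OF g(1) k(1)]
        by (simp add: left_diff_distrib)
      also have "cmod \<dots> \<le> (sqnorm M (\<lambda>x. f x - g x) / t + t * sqnorm M k) / 2"
        by (rule integral_mult_cnj_le[OF square_integrable_diff[OF f(1) g(1)] k(1) t])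
      also have "\<dots> \<le> (t + t * sqnorm M k) / 2"
        using g(3) t by (simp add: field_simps)
      finally show ?thesis by (simp add: C_def algebra_simps)
    qed
    have "cmod (LINT x|M. f x * cnj (k x)) \<le> 0 + e" if e: "0 < e" for e
      using small[of "e / C"] e C by simp
    then have "cmod (LINT x|M. f x * cnj (k x)) \<le> 0" by (rule field_le_epsilon)
    then show ?thesis
      using f k by (simp add: cinner_L2 square_integrable_measurable)
  qed
  with f show "F \<in> orth_compl (L2 M) T" by (simp add: orth_compl_def)
qed

section \<open>Multiplication operators and their square roots\<close>

text \<open>\<open>mult_op\<close> speaks of some representative. Both domain conditions and the
  resulting class are invariant under changes on null sets, so any measurable representative may be
  inspected.\<close>

lemma mult_op_iff:
  assumes [measurable]: "f \<in> borel_measurable M" "u \<in> borel_measurable M"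
  shows "(ae_class M f, G) \<in> mult_op M u \<longleftrightarrow>
    square_integrable M f \<and> square_integrable M (\<lambda>x. u x * f x) \<and> G = ae_class M (\<lambda>x. u x * f x)"
proof
  assume "(ae_class M f, G) \<in> mult_op M u"
  then obtain f' where f': "square_integrable M f'" "square_integrable M (\<lambda>x. u x * f' x)"
    and eq: "ae_class M f = ae_class M f'" "G = ae_class M (\<lambda>x. u x * f' x)"
    by (auto simp: mult_op_def)
  from eq(1) have ae: "AE x in M. f x = f' x" by (simp add: ae_class_eq_iff)
  then have ae': "AE x in M. u x * f x = u x * f' x" by auto
  have "square_integrable M f"
    by (rule square_integrable_cong_AE[OF f'(1) _ ae]) simp
  moreover have "square_integrable M (\<lambda>x. u x * f x)"
    by (rule square_integrable_cong_AE[OF f'(2) _ ae']) simp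
  ultimately show "square_integrable M f \<and> square_integrable M (\<lambda>x. u x * f x) \<and> G = ae_class M (\<lambda>x. u x * f x)"
    using eq(2) ae_class_cong[OF ae'] by simp
qed (auto simp: mult_op_def)

lemma mult_opE:
  assumes "(F, G) \<in> mult_op M u"
  obtains f where "square_integrable M f" "square_integrable M (\<lambda>x. u x * f x)"
    "F = ae_class M f" "G = ae_class M (\<lambda>x. u x * f x)"
  using assms by (auto simp: mult_op_def)

lemma linear_op_mult_op:
  assumes u [measurable]: "u \<in> borel_measurable M"
  shows "linear_op (L2 M) (L2 M) (mult_op M u)"
  unfolding linear_op_def
proof (intro conjI allI impI)
  show "mult_op M u \<subseteq> vecs (L2 M) \<times> vecs (L2 M)"
    by (auto elim!: mult_opE)
  show "single_valued (mult_op M u)"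
  proof (rule single_valuedI)
    fix F G H assume "(F, G) \<in> mult_op M u" and FH: "(F, H) \<in> mult_op M u"
    then obtain f where f: "square_integrable M f" "F = ae_class M f" "G = ae_class M (\<lambda>x. u x * f x)"
      by (auto elim: mult_opE)
    from FH show "G = H" by (simp add: f mult_op_iff square_integrable_measurable)
  qed
  show "(vzero (L2 M), vzero (L2 M)) \<in> mult_op M u"
    by (simp add: vzero_L2 mult_op_iff)
next
  fix F G F' G' assume "(F, G) \<in> mult_op M u" "(F', G') \<in> mult_op M u"
  then obtain f f' where f: "square_integrable M f" "square_integrable M (\<lambda>x. u x * f x)"
    "F = ae_class M f" "G = ae_class M (\<lambda>x. u x * f x)"
    and f': "square_integrable M f'" "square_integrable M (\<lambda>x. u x * f' x)"
    "F' = ae_class M f'" "G' = ae_class M (\<lambda>x. u x * f' x)"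
    by (auto elim!: mult_opE)
  then show "(vadd (L2 M) F F', vadd (L2 M) G G') \<in> mult_op M u"
    using square_integrable_add[OF f(1) f'(1)] square_integrable_add[OF f(2) f'(2)]
    by (simp add: vadd_L2 square_integrable_measurable mult_op_iff distrib_left)
next
  fix c F G assume "(F, G) \<in> mult_op M u"
  then obtain f where f: "square_integrable M f" "square_integrable M (\<lambda>x. u x * f x)"
    "F = ae_class M f" "G = ae_class M (\<lambda>x. u x * f x)"
    by (auto elim!: mult_opE)
  then show "(vscale (L2 M) c F, vscale (L2 M) c G) \<in> mult_op M u"
    using square_integrable_scale[OF f(1), of c] square_integrable_scale[OF f(2), of c]
    by (simp add: vscale_L2 square_integrable_measurable mult_op_iff mult.left_commute)
qed

lemma square_integrable_mult_bounded:
  assumes f: "square_integrable M f" and r [measurable]: "r \<in> borel_measurable M"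
    and le: "\<And>x. f x \<noteq> 0 \<Longrightarrow> \<bar>r x\<bar> \<le> c"
  shows "square_integrable M (\<lambda>x. complex_of_real (r x) * f x)"
    and "sqnorm M (\<lambda>x. complex_of_real (r x) * f x) \<le> c\<^sup>2 * sqnorm M f"
proof -
  note [measurable] = square_integrable_measurable[OF f]
  have "cmod (complex_of_real (r x) * f x) \<le> c * cmod (f x)" for x
    using le[of x] by (cases "f x = 0") (auto simp: norm_mult intro: mult_right_mono)
  then have "AE x in M. cmod (complex_of_real (r x) * f x) \<le> c * cmod (f x)" by blast
  then show "square_integrable M (\<lambda>x. complex_of_real (r x) * f x)"
    "sqnorm M (\<lambda>x. complex_of_real (r x) * f x) \<le> c\<^sup>2 * sqnorm M f"
    by (rule square_integrable_bound[OF f, rotated]; simp)+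
qed

text \<open>The truncation of r g - k to {|r| \<le> n} is itself an admissible test function, so the
  weak identity makes its norm vanish; the sets {|r| \<le> n} exhaust the space. The lemma serves
  for the adjoint of a multiplication operator, for C^*C and for the comparison of square
  roots.\<close>

lemma AE_eq_mult_of_weak:
  assumes r [measurable]: "r \<in> borel_measurable M"
    and g: "square_integrable M g" and k: "square_integrable M k"
    and weak: "\<And>f n. square_integrable M f \<Longrightarrow> (\<And>x. f x \<noteq> 0 \<Longrightarrow> \<bar>r x\<bar> \<le> real n) \<Longrightarrow>
      (LINT x|M. complex_of_real (r x) * f x * cnj (g x)) = (LINT x|M. f x * cnj (k x))"
  shows "AE x in M. k x = complex_of_real (r x) * g x"
proof -
  note [measurable] = square_integrable_measurable[OF g] square_integrable_measurable[OF k]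
  have "AE x in M. \<bar>r x\<bar> \<le> real n \<longrightarrow> k x = complex_of_real (r x) * g x" for n
  proof -
    define f where "f = (\<lambda>x. if \<bar>r x\<bar> \<le> real n then complex_of_real (r x) * g x - k x else 0)"
    have "square_integrable M
        (\<lambda>x. complex_of_real (r x) * (if \<bar>r x\<bar> \<le> real n then g x else 0)
             - (if \<bar>r x\<bar> \<le> real n then k x else 0))"
      by (intro square_integrable_diff square_integrable_restrict k
            square_integrable_mult_bounded(1)[where c = "real n"] g)
         (auto split: if_splits)
    then have f: "square_integrable M f"
      by (rule back_subst[where P = "square_integrable M"]) (auto simp: f_def)
    have supp: "\<bar>r x\<bar> \<le> real n" if "f x \<noteq> 0" for x using that by (auto simp: f_def split: if_splits)
    have rf: "square_integrable M (\<lambda>x. complex_of_real (r x) * f x)"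
      by (rule square_integrable_mult_bounded(1)[OF f r supp])
    have "complex_of_real (sqnorm M f) = (LINT x|M. f x * cnj (f x))"
      by (simp add: integral_mult_cnj_self)
    \<comment> \<open>Since r is real, \<open>cnj (f x)\<close> is r cnj g - cnj k on the support of
      \<open>f\<close>; elsewhere both integrands vanish.\<close>
    also have "\<dots> = (LINT x|M. complex_of_real (r x) * f x * cnj (g x) - f x * cnj (k x))"
      by (rule Bochner_Integration.integral_cong) (auto simp: f_def algebra_simps)
    also have "\<dots> = 0"
      using integrable_mult_cnj[OF rf g] integrable_mult_cnj[OF f k] weak[OF f supp] by simp
    finally have "sqnorm M f = 0" by simp
    then have "AE x in M. f x = 0" by (simp add: sqnorm_eq_0_iff[OF f])
    then show ?thesis by eventually_elim (auto simp: f_def)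
  qed
  then have "AE x in M. \<forall>n. \<bar>r x\<bar> \<le> real n \<longrightarrow> k x = complex_of_real (r x) * g x"
    unfolding AE_all_countable by blast
  then show ?thesis
  proof eventually_elim
    case (elim x)
    then show ?case using real_arch_simple[of "\<bar>r x\<bar>"] by auto
  qed
qed

lemma densely_defined_mult_op:
  assumes r [measurable]: "r \<in> borel_measurable M"
  shows "densely_defined (L2 M) (mult_op M (\<lambda>x. complex_of_real (r x)))"
  unfolding densely_defined_def
proof (intro equalityI subsetI)
  fix F assume "F \<in> vecs (L2 M)"
  then obtain f where f: "square_integrable M f" "F = ae_class M f" by (rule vecs_L2E)
  note [measurable] = square_integrable_measurable[OF f(1)]
  let ?s = "\<lambda>n x. if \<bar>r x\<bar> \<le> real n then f x else 0"
  have s: "square_integrable M (?s n)" for n by (rule square_integrable_restrict[OF f(1)]) simp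
  have "square_integrable M (\<lambda>x. complex_of_real (r x) * ?s n x)" for n
    by (rule square_integrable_mult_bounded(1)[OF s, where c = "real n"]) (auto split: if_splits)
  with s have "(ae_class M (?s n), ae_class M (\<lambda>x. complex_of_real (r x) * ?s n x))
      \<in> mult_op M (\<lambda>x. complex_of_real (r x))" for n
    unfolding mult_op_def by blast
  then have dom: "ae_class M (?s n) \<in> Domain (mult_op M (\<lambda>x. complex_of_real (r x)))" for n
    by blast
  have ev: "eventually (\<lambda>n. \<bar>r x\<bar> \<le> real n) sequentially" for x
    using filterlim_real_sequentially unfolding filterlim_at_top by blast
  have "(\<lambda>n. sqnorm M (\<lambda>x. f x - ?s n x)) \<longlonglongrightarrow> 0"
    by (rule sqnorm_truncation_tendsto_0[OF f(1)]) (use ev in auto)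
  with dom show "F \<in> vclosure (L2 M) (Domain (mult_op M (\<lambda>x. complex_of_real (r x))))"
    unfolding f(2) by (intro vclosure_L2I[OF f(1)]) auto
qed (simp add: vclosure_def)

text \<open>Symmetry holds because r is real. The other inclusion uses that \<open>mult_op\<close>
  has its maximal domain: a weak image k of g equals r g a.e., and this alone puts g into the
  domain.\<close>

lemma adjoint_mult_op:
  assumes r [measurable]: "r \<in> borel_measurable M"
  shows "adjoint_op (L2 M) (L2 M) (mult_op M (\<lambda>x. complex_of_real (r x)))
    = mult_op M (\<lambda>x. complex_of_real (r x))"
proof (intro set_eqI iffI; clarify)
  fix G K assume GK: "(G, K) \<in> adjoint_op (L2 M) (L2 M) (mult_op M (\<lambda>x. complex_of_real (r x)))"
  then obtain g k where g: "square_integrable M g" "G = ae_class M g"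
    and k: "square_integrable M k" "K = ae_class M k"
    by (auto simp: adjoint_op_def elim!: vecs_L2E)
  note [measurable] = square_integrable_measurable[OF g(1)] square_integrable_measurable[OF k(1)]
  have "AE x in M. k x = complex_of_real (r x) * g x"
  proof (rule AE_eq_mult_of_weak[OF r g(1) k(1)])
    fix f :: "'a \<Rightarrow> complex" and n
    assume f: "square_integrable M f" and supp: "\<And>x. f x \<noteq> 0 \<Longrightarrow> \<bar>r x\<bar> \<le> real n"
    note [measurable] = square_integrable_measurable[OF f]
    have "square_integrable M (\<lambda>x. complex_of_real (r x) * f x)"
      by (rule square_integrable_mult_bounded(1)[OF f r supp])
    with f have "(ae_class M f, ae_class M (\<lambda>x. complex_of_real (r x) * f x))
        \<in> mult_op M (\<lambda>x. complex_of_real (r x))"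
      unfolding mult_op_def by blast
    with GK show "(LINT x|M. complex_of_real (r x) * f x * cnj (g x)) = (LINT x|M. f x * cnj (k x))"
      by (auto simp: adjoint_op_def g(2) k(2) cinner_L2)
  qed
  then have eq: "AE x in M. complex_of_real (r x) * g x = k x" by auto
  have "square_integrable M (\<lambda>x. complex_of_real (r x) * g x)"
    by (rule square_integrable_cong_AE[OF k(1) _ eq]) simp
  with g k show "(G, K) \<in> mult_op M (\<lambda>x. complex_of_real (r x))"
    using eq by (simp add: mult_op_iff ae_class_cong)
next
  fix G K assume "(G, K) \<in> mult_op M (\<lambda>x. complex_of_real (r x))"
  then obtain g where g: "square_integrable M g" "square_integrable M (\<lambda>x. complex_of_real (r x) * g x)"
    "G = ae_class M g" "K = ae_class M (\<lambda>x. complex_of_real (r x) * g x)"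
    by (rule mult_opE)
  note [measurable] = square_integrable_measurable[OF g(1)]
  have "cinner (L2 M) AF G = cinner (L2 M) F K" if "(F, AF) \<in> mult_op M (\<lambda>x. complex_of_real (r x))" for F AF
  proof -
    from that obtain f where f: "square_integrable M f" "F = ae_class M f"
      "AF = ae_class M (\<lambda>x. complex_of_real (r x) * f x)" by (rule mult_opE)
    note [measurable] = square_integrable_measurable[OF f(1)]
    show ?thesis
      unfolding f g by (simp add: cinner_L2 mult.assoc mult.left_commute)
  qed
  moreover have "G \<in> vecs (L2 M)" "K \<in> vecs (L2 M)" using g by simp_all
  ultimately show "(G, K) \<in> adjoint_op (L2 M) (L2 M) (mult_op M (\<lambda>x. complex_of_real (r x)))"
    unfolding adjoint_op_def by blast
qed

lemma selfadjoint_mult_op: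
  "r \<in> borel_measurable M \<Longrightarrow> selfadjoint_op (L2 M) (mult_op M (\<lambda>x. complex_of_real (r x)))"
  by (simp add: selfadjoint_op_def linear_op_mult_op densely_defined_mult_op adjoint_mult_op)

lemma positive_mult_op:
  assumes r [measurable]: "r \<in> borel_measurable M" and nonneg: "\<And>x. 0 \<le> r x"
  shows "positive_op (L2 M) (mult_op M (\<lambda>x. complex_of_real (r x)))"
  unfolding positive_op_def
proof clarify
  fix F AF assume "(F, AF) \<in> mult_op M (\<lambda>x. complex_of_real (r x))"
  then obtain f where f: "square_integrable M f" "F = ae_class M f"
    "AF = ae_class M (\<lambda>x. complex_of_real (r x) * f x)" by (rule mult_opE)
  note [measurable] = square_integrable_measurable[OF f(1)]
  have "cinner (L2 M) AF F = (LINT x|M. complex_of_real (r x) * (f x * cnj (f x)))"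
    unfolding f by (simp add: cinner_L2 mult.assoc)
  also have "\<dots> = (LINT x|M. complex_of_real (r x * (cmod (f x))\<^sup>2))"
    unfolding complex_norm_square[symmetric] of_real_mult ..
  also have "\<dots> = complex_of_real (LINT x|M. r x * (cmod (f x))\<^sup>2)"
    by (rule integral_complex_of_real)
  finally show "cinner (L2 M) AF F \<in> \<real>\<^sub>\<ge>\<^sub>0"
    using nonneg by simp
qed

text \<open>What has to be checked is that the domain of multiplication by r^2 lies in that of
  multiplication by r: from |a| \<le> 1 + a^2 one gets |r f| \<le> |f| + |r^2 f|.\<close>

lemma mult_op_comp_self:
  assumes r [measurable]: "r \<in> borel_measurable M"
  shows "mult_op M (\<lambda>x. complex_of_real (r x)) O mult_op M (\<lambda>x. complex_of_real (r x))
    = mult_op M (\<lambda>x. complex_of_real ((r x)\<^sup>2))"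
proof (intro set_eqI iffI; clarify)
  fix F G H assume "(F, G) \<in> mult_op M (\<lambda>x. complex_of_real (r x))"
    and GH: "(G, H) \<in> mult_op M (\<lambda>x. complex_of_real (r x))"
  then obtain f where f: "square_integrable M f" "F = ae_class M f"
    and G: "G = ae_class M (\<lambda>x. complex_of_real (r x) * f x)" by (auto elim: mult_opE)
  note [measurable] = square_integrable_measurable[OF f(1)]
  from GH show "(F, H) \<in> mult_op M (\<lambda>x. complex_of_real ((r x)\<^sup>2))"
    by (simp add: G f mult_op_iff power2_eq_square mult.assoc)
next
  fix F H assume "(F, H) \<in> mult_op M (\<lambda>x. complex_of_real ((r x)\<^sup>2))"
  then obtain f where f: "square_integrable M f" "square_integrable M (\<lambda>x. complex_of_real ((r x)\<^sup>2) * f x)"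
    "F = ae_class M f" "H = ae_class M (\<lambda>x. complex_of_real ((r x)\<^sup>2) * f x)" by (rule mult_opE)
  note [measurable] = square_integrable_measurable[OF f(1)]
  have "square_integrable M (\<lambda>x. complex_of_real (cmod (f x) + cmod (complex_of_real ((r x)\<^sup>2) * f x)))"
    using square_integrable_add[of M "\<lambda>x. complex_of_real (cmod (f x))"
        "\<lambda>x. complex_of_real (cmod (complex_of_real ((r x)\<^sup>2) * f x))"] f(1,2)
    by (simp add: square_integrable_def)
  then have rf: "square_integrable M (\<lambda>x. complex_of_real (r x) * f x)"
  proof (rule square_integrable_bound(1)[where c = 1])
    have "\<bar>a\<bar> * b \<le> b + a\<^sup>2 * b" if "0 \<le> b" for a b :: real
    proof -
      have "2 * \<bar>a\<bar> \<le> a\<^sup>2 + 1" "0 \<le> a\<^sup>2"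
        using sum_squares_bound[of "\<bar>a\<bar>" 1] by simp_all
      then have "\<bar>a\<bar> \<le> 1 + a\<^sup>2" by linarith
      from mult_right_mono[OF this that] show ?thesis by (simp add: distrib_right)
    qed
    then show "AE x in M. cmod (complex_of_real (r x) * f x)
        \<le> 1 * cmod (complex_of_real (cmod (f x) + cmod (complex_of_real ((r x)\<^sup>2) * f x)))"
      by (simp add: norm_mult norm_power flip: of_real_mult of_real_add of_real_power)
  qed simp
  have "(F, ae_class M (\<lambda>x. complex_of_real (r x) * f x)) \<in> mult_op M (\<lambda>x. complex_of_real (r x))"
    using f rf by (simp add: mult_op_iff)
  moreover have "(ae_class M (\<lambda>x. complex_of_real (r x) * f x), H) \<in> mult_op M (\<lambda>x. complex_of_real (r x))"
    using f rf by (simp add: mult_op_iff power2_eq_square mult.assoc)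
  ultimately show "(F, H) \<in> mult_op M (\<lambda>x. complex_of_real (r x)) O mult_op M (\<lambda>x. complex_of_real (r x))"
    by blast
qed

section \<open>Uniqueness of the positive square root\<close>

lemma sqnorm_add:
  assumes f: "square_integrable M f" and g: "square_integrable M g"
  shows "sqnorm M (\<lambda>x. f x + g x) = sqnorm M f + 2 * Re (LINT x|M. f x * cnj (g x)) + sqnorm M g"
proof -
  note int = square_integrable_integrable[OF f] square_integrable_integrable[OF g]
  have fg: "integrable M (\<lambda>x. 2 * Re (f x * cnj (g x)))"
    using integrable_mult_cnj[OF f g] by (intro integrable_mult_right integrable_Re)
  have "sqnorm M (\<lambda>x. f x + g x)
      = (LINT x|M. (cmod (f x))\<^sup>2 + 2 * Re (f x * cnj (g x)) + (cmod (g x))\<^sup>2)"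
    unfolding sqnorm_def cmod_power2
    by (rule Bochner_Integration.integral_cong) (simp_all add: power2_eq_square algebra_simps)
  also have "\<dots> = sqnorm M f + (LINT x|M. 2 * Re (f x * cnj (g x))) + sqnorm M g"
    using int fg by (simp add: sqnorm_def)
  also have "(LINT x|M. 2 * Re (f x * cnj (g x))) = 2 * Re (LINT x|M. f x * cnj (g x))"
    by (simp only: integral_mult_right_zero integral_Re[OF integrable_mult_cnj[OF f g]])
  finally show ?thesis .
qed

text \<open>\<open>B\<close> is an arbitrary competitor in the description \<open>sqrt_op\<close>;
  the locale ends with its identification.\<close>

locale positive_sqrt_of_mult_op =
  fixes M :: "'a measure" and r :: "'a \<Rightarrow> real"
    and B :: "(('a \<Rightarrow> complex) set \<times> ('a \<Rightarrow> complex) set) set"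
  assumes r [measurable]: "r \<in> borel_measurable M" and r_nonneg: "\<And>x. 0 \<le> r x"
    and selfadjoint: "selfadjoint_op (L2 M) B" and positive: "positive_op (L2 M) B"
    and square: "B O B = mult_op M (\<lambda>x. complex_of_real ((r x)\<^sup>2))"
begin

lemma linear: "linear_op (L2 M) (L2 M) B"
  using selfadjoint by (simp add: selfadjoint_op_def)

lemma B_subset: "(F, G) \<in> B \<Longrightarrow> F \<in> vecs (L2 M) \<and> G \<in> vecs (L2 M)"
  using linear by (auto simp: linear_op_def)

lemma B_unique: "(F, G) \<in> B \<Longrightarrow> (F, H) \<in> B \<Longrightarrow> G = H"
  using linear by (auto simp: linear_op_def single_valued_def)

lemma B_add: "(F, G) \<in> B \<Longrightarrow> (F', G') \<in> B \<Longrightarrow> (vadd (L2 M) F F', vadd (L2 M) G G') \<in> B"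
  using linear by (auto simp: linear_op_def)

lemma B_scale: "(F, G) \<in> B \<Longrightarrow> (vscale (L2 M) c F, vscale (L2 M) c G) \<in> B"
  using linear by (auto simp: linear_op_def)

lemma symmetric:
  assumes "(F, G) \<in> B" "(F', G') \<in> B"
  shows "cinner (L2 M) G F' = cinner (L2 M) F G'"
proof -
  have "(F', G') \<in> adjoint_op (L2 M) (L2 M) B"
    using selfadjoint assms(2) by (simp add: selfadjoint_op_def)
  then show ?thesis using assms(1) by (auto simp: adjoint_op_def)
qed

text \<open>Membership in the domain of \<open>B\<close> is only accessible through
  \<open>square\<close>: an element of the domain of multiplication by r^2 lies in that of
  \<open>B O B\<close>, and the intermediate vector of the composition is its image under
  \<open>B\<close>.\<close>

lemma B_total:
  assumes f: "square_integrable M f" and rf: "square_integrable M (\<lambda>x. complex_of_real ((r x)\<^sup>2) * f x)"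
  obtains g where "square_integrable M g" "(ae_class M f, ae_class M g) \<in> B"
    "(ae_class M g, ae_class M (\<lambda>x. complex_of_real ((r x)\<^sup>2) * f x)) \<in> B"
proof -
  have "(ae_class M f, ae_class M (\<lambda>x. complex_of_real ((r x)\<^sup>2) * f x)) \<in> B O B"
    unfolding square using f rf unfolding mult_op_def by blast
  then obtain G where G: "(ae_class M f, G) \<in> B"
    "(G, ae_class M (\<lambda>x. complex_of_real ((r x)\<^sup>2) * f x)) \<in> B" by blast
  moreover from B_subset[OF G(1)] obtain g where "square_integrable M g" "G = ae_class M g"
    by (auto elim: vecs_L2E)
  ultimately show thesis using that by blast
qed

lemma square_integrable_mult_square:
  assumes h: "square_integrable M h" and le: "\<And>x. h x \<noteq> 0 \<Longrightarrow> r x \<le> e"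
  shows "square_integrable M (\<lambda>x. complex_of_real ((r x)\<^sup>2) * h x)"
proof (rule square_integrable_mult_bounded(1)[OF h])
  show "\<bar>(r x)\<^sup>2\<bar> \<le> e\<^sup>2" if "h x \<noteq> 0" for x
    using le[OF that] r_nonneg[of x] by (simp add: power_mono)
qed simp

text \<open>With $k = (B - s)f$, positivity of $B$ gives
  $s\|k\| \le \|(B + s)k\| = \|(r^2 - s^2)f\|$.\<close>

lemma slice_bound:
  assumes s: "0 < s" and d: "0 \<le> d" and f: "square_integrable M f" and g: "square_integrable M g"
    and slice: "\<And>x. f x \<noteq> 0 \<Longrightarrow> s - d \<le> r x \<and> r x \<le> s"
    and fg: "(ae_class M f, ae_class M g) \<in> B"
  shows "sqnorm M (\<lambda>x. g x - complex_of_real (r x) * f x) \<le> 10 * d\<^sup>2 * sqnorm M f"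
proof -
  note [measurable] = square_integrable_measurable[OF f] square_integrable_measurable[OF g]
  have r2f: "square_integrable M (\<lambda>x. complex_of_real ((r x)\<^sup>2) * f x)"
    by (rule square_integrable_mult_square[OF f, of s]) (use slice in auto)
  have gr: "(ae_class M g, ae_class M (\<lambda>x. complex_of_real ((r x)\<^sup>2) * f x)) \<in> B"
    using B_total[OF f r2f] B_unique[OF fg] by metis
  define k where "k = (\<lambda>x. g x + (- complex_of_real s) * f x)"
  \<comment> \<open>\<open>m\<close> is the image of \<open>k\<close> under \<open>B\<close>,
    because \<open>B\<close> sends \<open>g\<close> to r^2 f.\<close>
  define m where "m = (\<lambda>x. complex_of_real ((r x)\<^sup>2) * f x + (- complex_of_real s) * g x)"
  have k: "square_integrable M k" unfolding k_def
    by (intro square_integrable_add g square_integrable_scale f)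
  have m: "square_integrable M m" unfolding m_def
    by (intro square_integrable_add r2f square_integrable_scale g)
  have sk: "square_integrable M (\<lambda>x. complex_of_real s * k x)"
    by (rule square_integrable_scale[OF k])
  note [measurable] = square_integrable_measurable[OF k] square_integrable_measurable[OF m]
  have km: "(ae_class M k, ae_class M m) \<in> B"
    using B_add[OF gr B_scale[OF fg, of "- complex_of_real s"]]
    by (simp add: vscale_L2 vadd_L2 k_def m_def)
  have "cinner (L2 M) (ae_class M m) (ae_class M k) \<in> \<real>\<^sub>\<ge>\<^sub>0"
    using positive km by (auto simp: positive_op_def)
  then have pos: "0 \<le> Re (LINT x|M. m x * cnj (k x))"
    by (auto simp: cinner_L2 complex_nonneg_Reals_iff)
  \<comment> \<open>In the expansion of ||m + s k||^2 the cross term is 2 s Re <m, k>, which is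
    nonnegative by positivity of \<open>B\<close>; dropping it and ||m||^2 leaves s^2
    ||k||^2.\<close>
  have "s\<^sup>2 * sqnorm M k \<le> sqnorm M (\<lambda>x. m x + complex_of_real s * k x)"
  proof -
    have "Re (LINT x|M. m x * cnj (complex_of_real s * k x)) = s * Re (LINT x|M. m x * cnj (k x))"
      by (simp add: mult.left_commute)
    then have "0 \<le> Re (LINT x|M. m x * cnj (complex_of_real s * k x))" using s pos by simp
    moreover have "sqnorm M (\<lambda>x. complex_of_real s * k x) = s\<^sup>2 * sqnorm M k"
      by (simp add: sqnorm_def norm_mult power_mult_distrib)
    ultimately show ?thesis unfolding sqnorm_add[OF m sk] by simp
  qed
  also have "(\<lambda>x. m x + complex_of_real s * k x) = (\<lambda>x. complex_of_real ((r x)\<^sup>2 - s\<^sup>2) * f x)"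
    by (auto simp: m_def k_def fun_eq_iff algebra_simps power2_eq_square)
  also have "sqnorm M \<dots> \<le> (2 * s * d)\<^sup>2 * sqnorm M f"
  proof (rule square_integrable_mult_bounded(2)[OF f])
    fix x assume "f x \<noteq> 0"
    from slice[OF this] have "s - d \<le> r x" "r x \<le> s" by auto
    then have "(s - r x) * (s + r x) \<le> d * (2 * s)"
      using r_nonneg[of x] s d by (intro mult_mono) auto
    moreover have "(r x)\<^sup>2 \<le> s\<^sup>2"
      using \<open>r x \<le> s\<close> r_nonneg[of x] by (rule power_mono)
    ultimately show "\<bar>(r x)\<^sup>2 - s\<^sup>2\<bar> \<le> 2 * s * d"
      by (simp add: power2_eq_square algebra_simps)
  qed simp
  finally have "s\<^sup>2 * sqnorm M k \<le> s\<^sup>2 * (4 * d\<^sup>2 * sqnorm M f)"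
    by (simp add: power_mult_distrib mult_ac)
  then have kle: "sqnorm M k \<le> 4 * d\<^sup>2 * sqnorm M f" using s by simp
  have "\<bar>r x - s\<bar> \<le> d" if "f x \<noteq> 0" for x using slice[OF that] by auto
  note rs = square_integrable_mult_bounded[where r = "\<lambda>x. r x - s", OF f _ this]
  have "sqnorm M (\<lambda>x. g x - complex_of_real (r x) * f x)
      = sqnorm M (\<lambda>x. k x - complex_of_real (r x - s) * f x)"
    by (simp add: k_def algebra_simps)
  \<comment> \<open>The constant 10 is 2 * 4 + 2 * 1: replacing r by s costs d^2, and 4 d^2 comes
    from |r^2 - s^2| \<le> 2 s d after s^2 has cancelled.\<close>
  also have "\<dots> \<le> 2 * sqnorm M k + 2 * sqnorm M (\<lambda>x. complex_of_real (r x - s) * f x)"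
    by (rule sqnorm_diff_le[OF k rs(1)]) simp_all
  also have "\<dots> \<le> 2 * (4 * d\<^sup>2 * sqnorm M f) + 2 * (d\<^sup>2 * sqnorm M f)"
    by (intro add_mono mult_left_mono kle rs(2)) simp_all
  also have "\<dots> = 10 * d\<^sup>2 * sqnorm M f" by (simp add: algebra_simps)
  finally show ?thesis .
qed

text \<open>Induction splits off the top slice. The bound is linear in the number j + 1 of slices,
  as the errors of the two parts are combined with a suitable weight and the parts of
  \<open>f\<close> have disjoint supports.\<close>

lemma slices_bound:
  assumes d: "0 < d" and f: "square_integrable M f" and g: "square_integrable M g"
    and supp: "\<And>x. f x \<noteq> 0 \<Longrightarrow> r x \<le> (real j + 1) * d"
    and fg: "(ae_class M f, ae_class M g) \<in> B"
  shows "sqnorm M (\<lambda>x. g x - complex_of_real (r x) * f x) \<le> 10 * (real j + 1) * d\<^sup>2 * sqnorm M f"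
  using f g supp fg
proof (induction j arbitrary: f g)
  case 0
  \<comment> \<open>The only slice is {0 \<le> r \<le> d}, that is, s = d.\<close>
  have "sqnorm M (\<lambda>x. g x - complex_of_real (r x) * f x) \<le> 10 * d\<^sup>2 * sqnorm M f"
    by (rule slice_bound[of d]) (use d 0 r_nonneg in auto)
  then show ?case unfolding of_nat_0 add_0 mult_1_right .
next
  case (Suc j)
  note f = Suc.prems(1) and g = Suc.prems(2) and supp = Suc.prems(3) and fg = Suc.prems(4)
  define c where "c = (real j + 1) * d"
  have c: "(real (Suc j) + 1) * d = c + d" "0 < c" using d by (simp_all add: c_def algebra_simps add_pos_nonneg)
  note [measurable] = square_integrable_measurable[OF f] square_integrable_measurable[OF g]
  define f1 where "f1 = (\<lambda>x. if r x \<le> c then f x else 0)"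
  define f2 where "f2 = (\<lambda>x. if c < r x then f x else 0)"
  have f1: "square_integrable M f1" unfolding f1_def by (rule square_integrable_restrict[OF f]) simp
  have f2: "square_integrable M f2" unfolding f2_def by (rule square_integrable_restrict[OF f]) simp
  have f12: "f = (\<lambda>x. f1 x + f2 x)" by (auto simp: f1_def f2_def)
  note [measurable] = square_integrable_measurable[OF f1] square_integrable_measurable[OF f2]
  have le1: "r x \<le> c" if "f1 x \<noteq> 0" for x using that by (auto simp: f1_def split: if_splits)
  have le2: "c + d - d \<le> r x \<and> r x \<le> c + d" if "f2 x \<noteq> 0" for x
    using that supp[of x] c by (auto simp: f2_def split: if_splits)
  obtain g1 where g1: "square_integrable M g1" "(ae_class M f1, ae_class M g1) \<in> B"
    using B_total[OF f1 square_integrable_mult_square[OF f1 le1]] by blast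
  obtain g2 where g2: "square_integrable M g2" "(ae_class M f2, ae_class M g2) \<in> B"
    using B_total[OF f2 square_integrable_mult_square[OF f2, of "c + d"]] le2 by blast
  note [measurable] = square_integrable_measurable[OF g1(1)] square_integrable_measurable[OF g2(1)]
  have rf1: "square_integrable M (\<lambda>x. complex_of_real (r x) * f1 x)"
    by (rule square_integrable_mult_bounded(1)[OF f1, where c = c]) (use le1 r_nonneg in auto)
  have rf2: "square_integrable M (\<lambda>x. complex_of_real (r x) * f2 x)"
    by (rule square_integrable_mult_bounded(1)[OF f2, where c = "c + d"]) (use le2 r_nonneg in auto)
  define D1 where "D1 = (\<lambda>x. g1 x - complex_of_real (r x) * f1 x)"
  define D2 where "D2 = (\<lambda>x. g2 x - complex_of_real (r x) * f2 x)"
  have D1: "square_integrable M D1" unfolding D1_def by (rule square_integrable_diff[OF g1(1) rf1])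
  have D2: "square_integrable M D2" unfolding D2_def by (rule square_integrable_diff[OF g2(1) rf2])
  have "(ae_class M f, ae_class M (\<lambda>x. g1 x + g2 x)) \<in> B"
    using B_add[OF g1(2) g2(2)] by (simp add: vadd_L2 f12)
  from B_unique[OF fg this] have "AE x in M. g x = g1 x + g2 x" by (simp add: ae_class_eq_iff)
  then have "sqnorm M (\<lambda>x. g x - complex_of_real (r x) * f x) = sqnorm M (\<lambda>x. D1 x + D2 x)"
    unfolding sqnorm_def D1_def D2_def
    by (intro integral_cong_AE) (auto simp: f12 algebra_simps)
  \<comment> \<open>The weight t = j + 1 balances the parts: (1 + 1/t) (j + 1) and 1 + t are both j
    + 2, the new number of slices.\<close>
  also have "\<dots> \<le> (1 + 1 / (real j + 1)) * sqnorm M D1 + (1 + (real j + 1)) * sqnorm M D2"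
    by (rule sqnorm_add_weighted[OF D1 D2]) simp
  also have "\<dots> \<le> (1 + 1 / (real j + 1)) * (10 * (real j + 1) * d\<^sup>2 * sqnorm M f1)
      + (1 + (real j + 1)) * (10 * d\<^sup>2 * sqnorm M f2)"
  proof (intro add_mono mult_left_mono)
    show "sqnorm M D1 \<le> 10 * (real j + 1) * d\<^sup>2 * sqnorm M f1"
      unfolding D1_def by (rule Suc.IH[OF f1 g1(1) _ g1(2)]) (use le1 in \<open>simp add: c_def\<close>)
    show "sqnorm M D2 \<le> 10 * d\<^sup>2 * sqnorm M f2"
      unfolding D2_def by (rule slice_bound[of "c + d"]) (use c d f2 g2 le2 in auto)
  qed auto
  also have "\<dots> = 10 * (real (Suc j) + 1) * d\<^sup>2 * (sqnorm M f1 + sqnorm M f2)"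
    by (simp add: field_simps)
  also have "sqnorm M f1 + sqnorm M f2 = sqnorm M f"
  proof -
    have "sqnorm M f1 + sqnorm M f2 = (LINT x|M. (cmod (f1 x))\<^sup>2 + (cmod (f2 x))\<^sup>2)"
      using square_integrable_integrable[OF f1] square_integrable_integrable[OF f2]
      by (simp add: sqnorm_def)
    also have "\<dots> = sqnorm M f"
      unfolding sqnorm_def by (rule Bochner_Integration.integral_cong) (auto simp: f1_def f2_def)
    finally show ?thesis .
  qed
  finally show ?case .
qed

lemma B_eq_mult_on_truncated:
  assumes f: "square_integrable M f" and supp: "\<And>x. f x \<noteq> 0 \<Longrightarrow> \<bar>r x\<bar> \<le> real n"
  shows "(ae_class M f, ae_class M (\<lambda>x. complex_of_real (r x) * f x)) \<in> B"
proof -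
  note [measurable] = square_integrable_measurable[OF f]
  have r2f: "square_integrable M (\<lambda>x. complex_of_real ((r x)\<^sup>2) * f x)"
    by (rule square_integrable_mult_square[OF f, of "real n"]) (use supp r_nonneg in auto)
  obtain g where g: "square_integrable M g" "(ae_class M f, ae_class M g) \<in> B"
    using B_total[OF f r2f] by blast
  note [measurable] = square_integrable_measurable[OF g(1)]
  have D: "square_integrable M (\<lambda>x. g x - complex_of_real (r x) * f x)"
    by (rule square_integrable_diff[OF g(1) square_integrable_mult_bounded(1)[OF f r supp]])
  have bound: "sqnorm M (\<lambda>x. g x - complex_of_real (r x) * f x)
      \<le> 10 * (real n + 1)\<^sup>2 * sqnorm M f * inverse (real (Suc j))" for j
  proof -
    \<comment> \<open>The j + 1 slices of this width cover {r \<le> n + 1}; n + 1 instead of n keeps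
      the width positive for n = 0. The resulting bound is of order 1 / (j + 1).\<close>
    define d where "d = (real n + 1) / (real j + 1)"
    have "sqnorm M (\<lambda>x. g x - complex_of_real (r x) * f x) \<le> 10 * (real j + 1) * d\<^sup>2 * sqnorm M f"
    proof (rule slices_bound[OF _ f g(1) _ g(2)])
      show "0 < d" by (simp add: d_def)
      show "r x \<le> (real j + 1) * d" if "f x \<noteq> 0" for x
        using supp[OF that] by (simp add: d_def)
    qed
    also have "\<dots> = 10 * (real n + 1)\<^sup>2 * sqnorm M f * inverse (real (Suc j))"
    proof -
      have "10 * a * (b / a)\<^sup>2 * c = 10 * b\<^sup>2 * c * inverse a" if "a \<noteq> 0" for a b c :: real
        using that by (simp add: power2_eq_square field_simps)
      from this[of "real j + 1"] show ?thesis by (simp add: d_def add.commute)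
    qed
    finally show ?thesis .
  qed
  have "(\<lambda>j. 10 * (real n + 1)\<^sup>2 * sqnorm M f * inverse (real (Suc j))) \<longlonglongrightarrow> 0"
    using tendsto_mult_left[OF LIMSEQ_inverse_real_of_nat] by simp
  then have "sqnorm M (\<lambda>x. g x - complex_of_real (r x) * f x) \<le> 0"
    by (rule LIMSEQ_le_const) (use bound in auto)
  then have "sqnorm M (\<lambda>x. g x - complex_of_real (r x) * f x) = 0"
    by (intro antisym) simp_all
  then have "AE x in M. g x - complex_of_real (r x) * f x = 0"
    by (simp add: sqnorm_eq_0_iff[OF D])
  then have "AE x in M. g x = complex_of_real (r x) * f x" by auto
  from ae_class_cong[OF this] g(2) show ?thesis by simp
qed

text \<open>A truncated p has image r p under \<open>B\<close>, so symmetry reads <r p, f> = <p, g>,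
  which is precisely the weak identity required by \<open>AE_eq_mult_of_weak\<close>.\<close>

lemma B_subset_mult_op: "B \<subseteq> mult_op M (\<lambda>x. complex_of_real (r x))"
proof clarify
  fix F G assume FG: "(F, G) \<in> B"
  then obtain f g where f: "square_integrable M f" "F = ae_class M f"
    and g: "square_integrable M g" "G = ae_class M g"
    using B_subset by (meson vecs_L2E)
  note [measurable] = square_integrable_measurable[OF f(1)] square_integrable_measurable[OF g(1)]
  have "AE x in M. g x = complex_of_real (r x) * f x"
  proof (rule AE_eq_mult_of_weak[OF r f(1) g(1)])
    fix p :: "'a \<Rightarrow> complex" and n
    assume p: "square_integrable M p" and supp: "\<And>x. p x \<noteq> 0 \<Longrightarrow> \<bar>r x\<bar> \<le> real n"
    note [measurable] = square_integrable_measurable[OF p]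
    show "(LINT x|M. complex_of_real (r x) * p x * cnj (f x)) = (LINT x|M. p x * cnj (g x))"
      using symmetric[OF B_eq_mult_on_truncated[OF p supp] FG] by (simp add: f(2) g(2) cinner_L2)
  qed
  then have eq: "AE x in M. complex_of_real (r x) * f x = g x" by auto
  have "square_integrable M (\<lambda>x. complex_of_real (r x) * f x)"
    by (rule square_integrable_cong_AE[OF g(1) _ eq]) simp
  then show "(F, G) \<in> mult_op M (\<lambda>x. complex_of_real (r x))"
    using f g eq by (simp add: mult_op_iff ae_class_cong)
qed

text \<open>A selfadjoint operator has no proper selfadjoint extension, because taking adjoints
  reverses inclusions.\<close>

lemma B_eq_mult_op: "B = mult_op M (\<lambda>x. complex_of_real (r x))"
proof (rule equalityI[OF B_subset_mult_op])
  have "mult_op M (\<lambda>x. complex_of_real (r x)) = adjoint_op (L2 M) (L2 M) (mult_op M (\<lambda>x. complex_of_real (r x)))"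
    by (simp add: adjoint_mult_op)
  also have "\<dots> \<subseteq> adjoint_op (L2 M) (L2 M) B"
    using B_subset_mult_op by (auto simp: adjoint_op_def)
  also have "\<dots> = B" using selfadjoint by (simp add: selfadjoint_op_def)
  finally show "mult_op M (\<lambda>x. complex_of_real (r x)) \<subseteq> B" .
qed

end

lemma sqrt_op_mult_op:
  assumes r: "r \<in> borel_measurable M" and nonneg: "\<And>x. 0 \<le> r x"
  shows "sqrt_op (L2 M) (mult_op M (\<lambda>x. complex_of_real ((r x)\<^sup>2))) = mult_op M (\<lambda>x. complex_of_real (r x))"
  unfolding sqrt_op_def
proof (rule the_equality)
  show "selfadjoint_op (L2 M) (mult_op M (\<lambda>x. complex_of_real (r x))) \<and>
    positive_op (L2 M) (mult_op M (\<lambda>x. complex_of_real (r x))) \<and>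
    mult_op M (\<lambda>x. complex_of_real (r x)) O mult_op M (\<lambda>x. complex_of_real (r x))
      = mult_op M (\<lambda>x. complex_of_real ((r x)\<^sup>2))"
    using assms by (intro conjI selfadjoint_mult_op positive_mult_op mult_op_comp_self)
next
  fix B assume "selfadjoint_op (L2 M) B \<and> positive_op (L2 M) B \<and>
    B O B = mult_op M (\<lambda>x. complex_of_real ((r x)\<^sup>2))"
  then interpret positive_sqrt_of_mult_op M r B by unfold_locales (use assms in auto)
  show "B = mult_op M (\<lambda>x. complex_of_real (r x))" by (rule B_eq_mult_op)
qed

section \<open>Composition operators\<close>

text \<open>Reduces linear statements to nonnegative real functions, where extended nonnegative
  integrals and Radon-Nikodym apply. The four parts are the positive and negative parts of Re f and
  Im f, each bounded by |f|.\<close>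

lemma square_integrable_induct [consumes 1, case_names nonneg add scale]:
  assumes f: "square_integrable M f"
    and nonneg: "\<And>u :: 'a \<Rightarrow> real. u \<in> borel_measurable M \<Longrightarrow> (\<And>x. 0 \<le> u x) \<Longrightarrow>
      square_integrable M (\<lambda>x. complex_of_real (u x)) \<Longrightarrow> P (\<lambda>x. complex_of_real (u x))"
    and add: "\<And>f g. square_integrable M f \<Longrightarrow> square_integrable M g \<Longrightarrow> P f \<Longrightarrow> P g \<Longrightarrow> P (\<lambda>x. f x + g x)"
    and scale: "\<And>c f. square_integrable M f \<Longrightarrow> P f \<Longrightarrow> P (\<lambda>x. c * f x)"
  shows "P f"
proof -
  note [measurable] = square_integrable_measurable[OF f]
  have part: "square_integrable M (\<lambda>x. complex_of_real (max 0 (u x)))"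
    if [measurable]: "u \<in> borel_measurable M" and le: "\<And>x. \<bar>u x\<bar> \<le> cmod (f x)" for u :: "'a \<Rightarrow> real"
  proof (rule square_integrable_bound(1)[OF f, where c = 1])
    have "cmod (complex_of_real (max 0 (u x))) \<le> 1 * cmod (f x)" for x
      using le[of x] by auto
    then show "AE x in M. cmod (complex_of_real (max 0 (u x))) \<le> 1 * cmod (f x)" by blast
  qed simp
  let ?p = "\<lambda>u x. complex_of_real (max 0 (u x))"
  let ?a = "?p (\<lambda>x. Re (f x))" and ?b = "?p (\<lambda>x. - Re (f x))"
    and ?c = "?p (\<lambda>x. Im (f x))" and ?d = "?p (\<lambda>x. - Im (f x))"
  have sq: "square_integrable M ?a" "square_integrable M ?b" "square_integrable M ?c" "square_integrable M ?d"
    by (rule part; simp add: abs_Re_le_cmod abs_Im_le_cmod)+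
  have P: "P ?a" "P ?b" "P ?c" "P ?d"
    by (rule nonneg; simp add: sq)+
  note sq' = square_integrable_scale square_integrable_add
  have "P (\<lambda>x. (?a x + (- 1) * ?b x) + (\<i> * ?c x + (- \<i>) * ?d x))"
    by (intro add scale P sq sq')
  also have "(\<lambda>x. (?a x + (- 1) * ?b x) + (\<i> * ?c x + (- \<i>) * ?d x)) = f"
    by (auto simp: fun_eq_iff complex_eq_iff max_def)
  finally show ?thesis .
qed

text \<open>Stands in for Cauchy-Schwarz where the factors are not yet known to be finite.\<close>

lemma ennreal_two_mult_le: "2 * (a * b) \<le> a\<^sup>2 + b\<^sup>2" for a b :: ennreal
proof (cases "a = \<infinity> \<or> b = \<infinity>")
  case False
  then obtain x y where "a = ennreal x" "0 \<le> x" "b = ennreal y" "0 \<le> y"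
    by (metis ennreal_cases infinity_ennreal_def)
  then show ?thesis
    using sum_squares_bound[of x y]
    by (simp add: ennreal_power numeral_mult_ennreal mult.assoc flip: ennreal_mult ennreal_plus)
qed (auto simp: power2_eq_square)

locale nonsingular_composition = sigma_finite_measure M for M :: "'a measure" +
  fixes \<phi> :: "'a \<Rightarrow> 'a"
  assumes nonsingular: "nonsingular M \<phi>"
    and dense: "densely_defined (L2 M) (comp_op M \<phi>)"
begin

section \<open>The measure h d\<mu> and changes of variables\<close>

abbreviation N where "N \<equiv> h_measure M \<phi>"

definition r :: "'a \<Rightarrow> real" where
  "r x = sqrt (enn2real (h_of M \<phi> x))"

lemma measurable_phi [measurable]: "\<phi> \<in> measurable M M"
  using nonsingular by (simp add: nonsingular_def)

lemma measurable_h [measurable]: "h_of M \<phi> \<in> borel_measurable M"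
  by (simp add: h_of_def)

lemma measurable_r [measurable]: "r \<in> borel_measurable M"
  unfolding r_def by measurable

lemma r_nonneg [simp]: "0 \<le> r x"
  by (simp add: r_def)

lemma sqrt_h_eq: "sqrt_h M \<phi> = (\<lambda>x. complex_of_real (r x))"
  by (auto simp: sqrt_h_def r_def)

lemma sets_h_measure [measurable_cong, simp]: "sets N = sets M"
  by (simp add: h_measure_def)

text \<open>The same measure is a density and an image measure; every change of variables below
  switches between the two. The image measure of a \<sigma>-finite measure need not be
  \<sigma>-finite, which is why its density may take the value infinity.\<close>

lemma h_measure_eq_distr: "N = distr M M \<phi>"
  unfolding h_measure_def h_of_def
  by (rule density_RN_deriv) (use nonsingular in \<open>auto simp: nonsingular_def\<close>)

lemma nn_integral_comp:
  assumes [measurable]: "p \<in> borel_measurable M"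
  shows "(\<integral>\<^sup>+x. p (\<phi> x) \<partial>M) = (\<integral>\<^sup>+x. h_of M \<phi> x * p x \<partial>M)"
proof -
  have "(\<integral>\<^sup>+x. p (\<phi> x) \<partial>M) = (\<integral>\<^sup>+x. p x \<partial>N)"
    unfolding h_measure_eq_distr by (simp add: nn_integral_distr)
  also have "\<dots> = (\<integral>\<^sup>+x. h_of M \<phi> x * p x \<partial>M)"
    unfolding h_measure_def by (simp add: nn_integral_density)
  finally show ?thesis .
qed

text \<open>The choice of representative is immaterial by nonsingularity: a \<mu>-null set is null
  for h d\<mu>, so its preimage under \<phi> is \<mu>-null.\<close>

lemma comp_op_iff:
  assumes f [measurable]: "f \<in> borel_measurable M"
  shows "(ae_class M f, G) \<in> comp_op M \<phi> \<longleftrightarrow>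
    square_integrable M f \<and> square_integrable M (f \<circ> \<phi>) \<and> G = ae_class M (f \<circ> \<phi>)"
proof
  assume "(ae_class M f, G) \<in> comp_op M \<phi>"
  then obtain f' where f': "square_integrable M f'" "square_integrable M (f' \<circ> \<phi>)"
    and eq: "ae_class M f = ae_class M f'" "G = ae_class M (f' \<circ> \<phi>)"
    by (auto simp: comp_op_def)
  from eq(1) have ae: "AE x in M. f x = f' x" by (simp add: ae_class_eq_iff)
  then have "AE x in N. f x = f' x" unfolding h_measure_def by (auto simp: AE_density)
  then have "AE x in M. f (\<phi> x) = f' (\<phi> x)"
    unfolding h_measure_eq_distr by (rule AE_distrD[OF measurable_phi])
  then have ae': "AE x in M. (f \<circ> \<phi>) x = (f' \<circ> \<phi>) x" by simp
  have "square_integrable M f" by (rule square_integrable_cong_AE[OF f'(1) f ae])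
  moreover have "square_integrable M (f \<circ> \<phi>)"
    by (rule square_integrable_cong_AE[OF f'(2) _ ae']) simp
  ultimately show "square_integrable M f \<and> square_integrable M (f \<circ> \<phi>) \<and> G = ae_class M (f \<circ> \<phi>)"
    using eq(2) ae_class_cong[OF ae'] by (simp add: o_def)
qed (auto simp: comp_op_def)

lemma comp_opE:
  assumes "(F, G) \<in> comp_op M \<phi>"
  obtains f where "square_integrable M f" "square_integrable M (f \<circ> \<phi>)"
    "F = ae_class M f" "G = ae_class M (f \<circ> \<phi>)"
  using assms by (auto simp: comp_op_def)

text \<open>Every element of the domain vanishes where $\mathsf h_\phi = \infty$, so the domain is
  orthogonal to the indicators of subsets of that set.\<close>

lemma h_finite: "AE x in M. h_of M \<phi> x \<noteq> \<infinity>"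
proof -
  obtain A :: "nat \<Rightarrow> 'a set" where A: "range A \<subseteq> sets M" "(\<Union>i. A i) = space M"
    "\<And>i. emeasure M (A i) \<noteq> \<infinity>"
    using sigma_finite by metis
  have "AE x in M. \<not> (h_of M \<phi> x = \<infinity> \<and> x \<in> A i)" for i
  proof -
    have [measurable]: "A i \<in> sets M" using A(1) by auto
    \<comment> \<open>Intersecting with a set of finite measure makes the indicator of {h =
      \<infinity>} square integrable.\<close>
    define e where "e = (\<lambda>x. if h_of M \<phi> x = \<infinity> \<and> x \<in> A i then 1 else 0 :: complex)"
    have [measurable]: "e \<in> borel_measurable M" unfolding e_def by measurable
    have "integrable M (\<lambda>x. (cmod (e x))\<^sup>2)"
    proof (rule Bochner_Integration.integrable_bound)
      show "integrable M (indicator (A i) :: 'a \<Rightarrow> real)"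
        using A(3)[of i] by (simp add: less_top)
    qed (auto simp: e_def split: split_indicator)
    then have e: "square_integrable M e" by (simp add: square_integrable_def)
    have "Domain (comp_op M \<phi>) \<subseteq> orth_compl (L2 M) {ae_class M e}"
    proof clarify
      fix F G assume "(F, G) \<in> comp_op M \<phi>"
      then obtain f where f: "square_integrable M f" "square_integrable M (f \<circ> \<phi>)" "F = ae_class M f"
        by (rule comp_opE)
      note [measurable] = square_integrable_measurable[OF f(1)]
      have "(\<integral>\<^sup>+x. h_of M \<phi> x * ennreal ((cmod (f x))\<^sup>2) \<partial>M) = (\<integral>\<^sup>+x. ennreal ((cmod (f (\<phi> x)))\<^sup>2) \<partial>M)"
        by (subst nn_integral_comp) simp_all
      also have "\<dots> < \<infinity>"
        using square_integrable_integrable[OF f(2)] by (simp add: integrable_iff_bounded)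
      finally have "AE x in M. h_of M \<phi> x * ennreal ((cmod (f x))\<^sup>2) \<noteq> \<infinity>"
        by (intro nn_integral_PInf_AE) auto
      then have "AE x in M. f x * cnj (e x) = 0"
        by eventually_elim (auto simp: e_def ennreal_top_mult split: if_splits)
      then have "(LINT x|M. f x * cnj (e x)) = 0" by (rule integral_eq_zero_AE)
      then show "F \<in> orth_compl (L2 M) {ae_class M e}"
        using f by (simp add: orth_compl_def cinner_L2)
    qed
    \<comment> \<open>The domain is dense, so everything is orthogonal to \<open>e\<close>, in
      particular \<open>e\<close> itself.\<close>
    from vclosure_subset_orth_compl[OF this] e dense
    have "ae_class M e \<in> orth_compl (L2 M) {ae_class M e}"
      by (auto simp: densely_defined_def)
    then have "sqnorm M e = 0"
      by (simp add: orth_compl_def cinner_L2 integral_mult_cnj_self)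
    then have "AE x in M. e x = 0" by (simp add: sqnorm_eq_0_iff[OF e])
    then show ?thesis by eventually_elim (auto simp: e_def split: if_splits)
  qed
  then have "AE x in M. \<forall>i. \<not> (h_of M \<phi> x = \<infinity> \<and> x \<in> A i)" unfolding AE_all_countable by blast
  with AE_space show ?thesis
  proof eventually_elim
    case (elim x)
    then have "x \<in> (\<Union>i. A i)" using A(2) by simp
    with elim show ?case by auto
  qed
qed

lemma ennreal_r_square: "AE x in M. h_of M \<phi> x = ennreal ((r x)\<^sup>2)"
  using h_finite by eventually_elim (simp add: r_def ennreal_enn2real less_top)

lemma h_measure_eq_density: "N = density M (\<lambda>x. ennreal ((r x)\<^sup>2))"
  unfolding h_measure_def by (rule density_cong) (use ennreal_r_square in auto)

lemma measurable_h_measure [simp]: "borel_measurable N = borel_measurable M"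
  by (rule measurable_cong_sets) simp_all

lemma integral_h_measure:
  fixes p :: "'a \<Rightarrow> complex"
  assumes [measurable]: "p \<in> borel_measurable M"
  shows "(LINT x|N. p x) = (LINT x|M. complex_of_real ((r x)\<^sup>2) * p x)"
  unfolding h_measure_eq_density by (subst integral_density) (simp_all add: scaleR_conv_of_real)

lemma integral_comp:
  fixes p :: "'a \<Rightarrow> complex"
  assumes [measurable]: "p \<in> borel_measurable M"
  shows "(LINT x|M. p (\<phi> x)) = (LINT x|N. p x)"
  unfolding h_measure_eq_distr by (subst integral_distr) simp_all

lemma square_integrable_h_measure_iff:
  assumes [measurable]: "f \<in> borel_measurable M"
  shows "square_integrable N f \<longleftrightarrow> square_integrable M (\<lambda>x. complex_of_real (r x) * f x)"
proof -
  have "integrable N (\<lambda>x. (cmod (f x))\<^sup>2) \<longleftrightarrow> integrable M (\<lambda>x. (r x)\<^sup>2 * (cmod (f x))\<^sup>2)"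
    unfolding h_measure_eq_density by (subst integrable_density) simp_all
  then show ?thesis by (simp add: square_integrable_def norm_mult power_mult_distrib)
qed

lemma square_integrable_comp_iff:
  assumes [measurable]: "f \<in> borel_measurable M"
  shows "square_integrable M (f \<circ> \<phi>) \<longleftrightarrow> square_integrable N f"
proof -
  have "integrable N (\<lambda>x. (cmod (f x))\<^sup>2) \<longleftrightarrow> integrable M (\<lambda>x. (cmod (f (\<phi> x)))\<^sup>2)"
    unfolding h_measure_eq_distr by (subst integrable_distr_eq) simp_all
  then show ?thesis by (simp add: square_integrable_def)
qed

lemma square_integrable_h_measure_measurable:
  "square_integrable N f \<Longrightarrow> f \<in> borel_measurable M"
  by (simp add: square_integrable_def)

lemma sqnorm_comp:
  assumes "f \<in> borel_measurable M"
  shows "sqnorm M (f \<circ> \<phi>) = sqnorm N f"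
  using assms unfolding sqnorm_def h_measure_eq_distr by (subst integral_distr) simp_all

lemma sqnorm_h_measure:
  assumes [measurable]: "f \<in> borel_measurable M"
  shows "sqnorm N f = sqnorm M (\<lambda>x. complex_of_real (r x) * f x)"
  unfolding sqnorm_def h_measure_eq_density
  by (subst integral_density) (simp_all add: norm_mult power_mult_distrib)

lemma AE_h_measure: "(AE x in N. P x) \<longleftrightarrow> (AE x in M. r x \<noteq> 0 \<longrightarrow> P x)"
proof -
  have "0 < ennreal ((r x)\<^sup>2) \<longleftrightarrow> r x \<noteq> 0" for x by (simp add: zero_less_power2)
  then show ?thesis unfolding h_measure_eq_density by (subst AE_density) simp_all
qed

lemma AE_comp: "AE x in N. P x \<Longrightarrow> AE x in M. P (\<phi> x)"
  unfolding h_measure_eq_distr by (rule AE_distrD[OF measurable_phi])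

text \<open>The set {r = 0} is null for N, because r^2 is the density of N, and N is the image of
  \<mu>. Division by r \<circ> \<phi> is therefore genuine outside a null set.\<close>

lemma r_comp_nonzero: "AE x in M. r (\<phi> x) \<noteq> 0"
  by (rule AE_comp) (simp add: AE_h_measure)

text \<open>By change of variables <p \<circ> \<phi>, f \<circ> \<phi>> is the integral of h p cnj
  f, so formally C^*C multiplies by h. The work lies in matching the domains.\<close>

lemma comp_op_adjoint_comp_op:
  "comp_op M \<phi> O adjoint_op (L2 M) (L2 M) (comp_op M \<phi>) = mult_op M (\<lambda>x. complex_of_real ((r x)\<^sup>2))"
proof (intro set_eqI iffI; clarify)
  fix F G K assume FG: "(F, G) \<in> comp_op M \<phi>" and GK: "(G, K) \<in> adjoint_op (L2 M) (L2 M) (comp_op M \<phi>)"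
  from FG obtain f where f: "square_integrable M f" "square_integrable M (f \<circ> \<phi>)"
    "F = ae_class M f" "G = ae_class M (f \<circ> \<phi>)" by (rule comp_opE)
  from GK obtain k where k: "square_integrable M k" "K = ae_class M k"
    by (auto simp: adjoint_op_def elim!: vecs_L2E)
  note [measurable] = square_integrable_measurable[OF f(1)] square_integrable_measurable[OF k(1)]
  have "AE x in M. k x = complex_of_real ((r x)\<^sup>2) * f x"
  proof (rule AE_eq_mult_of_weak[OF _ f(1) k(1)])
    fix p :: "'a \<Rightarrow> complex" and n
    assume p: "square_integrable M p" and supp: "\<And>x. p x \<noteq> 0 \<Longrightarrow> \<bar>(r x)\<^sup>2\<bar> \<le> real n"
    note [measurable] = square_integrable_measurable[OF p]
    \<comment> \<open>A bound for r on the support of \<open>p\<close> puts r p into L^2(\<mu>),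
      which is the condition for p \<circ> \<phi> to be square integrable.\<close>
    have "\<bar>r x\<bar> \<le> sqrt (real n)" if "p x \<noteq> 0" for x
      using supp[OF that] by (simp add: real_le_rsqrt)
    then have "square_integrable M (\<lambda>x. complex_of_real (r x) * p x)"
      by (intro square_integrable_mult_bounded(1)[OF p]) auto
    then have "(ae_class M p, ae_class M (p \<circ> \<phi>)) \<in> comp_op M \<phi>"
      using p by (simp add: comp_op_iff square_integrable_comp_iff square_integrable_h_measure_iff)
    then have "(LINT x|M. p (\<phi> x) * cnj (f (\<phi> x))) = (LINT x|M. p x * cnj (k x))"
      using GK by (auto simp: adjoint_op_def f(4) k(2) cinner_L2)
    moreover have "(LINT x|M. p (\<phi> x) * cnj (f (\<phi> x))) = (LINT x|M. complex_of_real ((r x)\<^sup>2) * p x * cnj (f x))"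
      using integral_comp[of "\<lambda>x. p x * cnj (f x)"] integral_h_measure[of "\<lambda>x. p x * cnj (f x)"]
      by (simp add: mult.assoc)
    ultimately show "(LINT x|M. complex_of_real ((r x)\<^sup>2) * p x * cnj (f x)) = (LINT x|M. p x * cnj (k x))"
      by simp
  qed simp
  then have eq: "AE x in M. complex_of_real ((r x)\<^sup>2) * f x = k x" by auto
  have "square_integrable M (\<lambda>x. complex_of_real ((r x)\<^sup>2) * f x)"
    by (rule square_integrable_cong_AE[OF k(1) _ eq]) simp
  then show "(F, K) \<in> mult_op M (\<lambda>x. complex_of_real ((r x)\<^sup>2))"
    using f(1,3) k(2) ae_class_cong[OF eq] by (simp add: mult_op_iff)
next
  fix F K assume "(F, K) \<in> mult_op M (\<lambda>x. complex_of_real ((r x)\<^sup>2))"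
  \<comment> \<open>Factoring r^2 as r r yields that r f is square integrable, hence that f lies in
    the domain of C.\<close>
  then have "(F, K) \<in> mult_op M (\<lambda>x. complex_of_real (r x)) O mult_op M (\<lambda>x. complex_of_real (r x))"
    by (simp only: mult_op_comp_self[OF measurable_r])
  then obtain G where FG: "(F, G) \<in> mult_op M (\<lambda>x. complex_of_real (r x))"
    and GK: "(G, K) \<in> mult_op M (\<lambda>x. complex_of_real (r x))" by blast
  from FG obtain f where f: "square_integrable M f" "square_integrable M (\<lambda>x. complex_of_real (r x) * f x)"
    "F = ae_class M f" "G = ae_class M (\<lambda>x. complex_of_real (r x) * f x)" by (rule mult_opE)
  note [measurable] = square_integrable_measurable[OF f(1)]
  from GK have rrf: "square_integrable M (\<lambda>x. complex_of_real (r x) * (complex_of_real (r x) * f x))"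
    and K: "K = ae_class M (\<lambda>x. complex_of_real (r x) * (complex_of_real (r x) * f x))"
    by (simp_all add: f(4) mult_op_iff)
  have fphi: "square_integrable M (f \<circ> \<phi>)"
    using f(2) by (simp add: square_integrable_comp_iff square_integrable_h_measure_iff)
  have "(F, ae_class M (f \<circ> \<phi>)) \<in> comp_op M \<phi>"
    using f(1,3) fphi by (simp add: comp_op_iff)
  moreover have "cinner (L2 M) Y (ae_class M (f \<circ> \<phi>)) = cinner (L2 M) X K" if XY: "(X, Y) \<in> comp_op M \<phi>" for X Y
  proof -
    from XY obtain p where p: "square_integrable M p" "X = ae_class M p" "Y = ae_class M (p \<circ> \<phi>)"
      by (rule comp_opE)
    note [measurable] = square_integrable_measurable[OF p(1)]
    have "(LINT x|M. p (\<phi> x) * cnj (f (\<phi> x))) = (LINT x|M. complex_of_real ((r x)\<^sup>2) * (p x * cnj (f x)))"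
      using integral_comp[of "\<lambda>x. p x * cnj (f x)"] integral_h_measure[of "\<lambda>x. p x * cnj (f x)"]
      by simp
    also have "\<dots> = (LINT x|M. p x * cnj (complex_of_real (r x) * (complex_of_real (r x) * f x)))"
      by (rule Bochner_Integration.integral_cong) (simp_all add: power2_eq_square mult_ac)
    finally show ?thesis unfolding p K by (simp add: cinner_L2)
  qed
  then have "(ae_class M (f \<circ> \<phi>), K) \<in> adjoint_op (L2 M) (L2 M) (comp_op M \<phi>)"
    using fphi rrf unfolding adjoint_op_def K by auto
  ultimately show "(F, K) \<in> comp_op M \<phi> O adjoint_op (L2 M) (L2 M) (comp_op M \<phi>)" by blast
qed

lemma abs_comp_op:
  "abs_op (L2 M) (L2 M) (comp_op M \<phi>) = mult_op M (\<lambda>x. complex_of_real (r x))"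
  unfolding abs_op_def comp_op_adjoint_comp_op by (rule sqrt_op_mult_op) simp_all

text \<open>The density \<open>k\<close> of \<open>(u \<mu>) \<circ> \<phi>\<^sup>-\<^sup>1\<close> with respect to \<open>\<mu>\<close> is divided by $\mathsf h_\phi$; that the
  quotient lies in $L^2(\mathsf h_\phi\,d\mu)$ follows by testing against its own truncations.\<close>

lemma comp_adjoint_nonneg:
  assumes [measurable]: "u \<in> borel_measurable M" and u0: "\<And>x. 0 \<le> u x"
    and usq: "square_integrable M (\<lambda>x. complex_of_real (u x))"
  obtains w :: "'a \<Rightarrow> real" where "w \<in> borel_measurable M" "\<forall>x. 0 \<le> w x"
    "square_integrable N (\<lambda>x. complex_of_real (w x))"
    "\<forall>p\<in>borel_measurable M.
      (\<integral>\<^sup>+x. ennreal (u x) * p (\<phi> x) \<partial>M) = (\<integral>\<^sup>+x. ennreal ((r x)\<^sup>2 * w x) * p x \<partial>M)"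
proof -
  define \<nu> where "\<nu> = distr (density M (\<lambda>x. ennreal (u x))) M \<phi>"
  have nu: "(\<integral>\<^sup>+x. p x \<partial>\<nu>) = (\<integral>\<^sup>+x. ennreal (u x) * p (\<phi> x) \<partial>M)"
    if [measurable]: "p \<in> borel_measurable M" for p
    unfolding \<nu>_def by (simp add: nn_integral_distr nn_integral_density)
  have "absolutely_continuous M \<nu>"
    unfolding absolutely_continuous_def
  proof
    fix A assume A: "A \<in> null_sets M"
    then have [measurable]: "A \<in> sets M" by auto
    have "AE x in M. x \<notin> A" by (rule AE_not_in[OF A])
    then have "AE x in N. x \<notin> A" unfolding AE_h_measure by eventually_elim simp
    then have "AE x in M. \<phi> x \<notin> A" by (rule AE_comp)
    then have "(\<integral>\<^sup>+x. ennreal (u x) * indicator A (\<phi> x) \<partial>M) = 0"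
      by (subst nn_integral_0_iff_AE) auto
    then have "emeasure \<nu> A = 0"
      using nu[of "indicator A"] by (simp add: \<nu>_def)
    then show "A \<in> null_sets \<nu>" by (simp add: null_sets_def \<nu>_def)
  qed
  then obtain k where k [measurable]: "k \<in> borel_measurable M" and "density M k = \<nu>"
    using Radon_Nikodym[of \<nu>] by (auto simp: \<nu>_def)
  then have uk: "(\<integral>\<^sup>+x. ennreal (u x) * p (\<phi> x) \<partial>M) = (\<integral>\<^sup>+x. k x * p x \<partial>M)"
    if [measurable]: "p \<in> borel_measurable M" for p
    using nu[of p] by (auto simp: nn_integral_density)
  define G where "G = (\<integral>\<^sup>+x. ennreal ((u x)\<^sup>2) \<partial>M)"
  have G: "G < \<infinity>"
    using square_integrable_integrable[OF usq] by (simp add: G_def integrable_iff_bounded)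
  \<comment> \<open>The pointwise bound 2 u p \<le> u^2 + p^2 holds in the extended reals; at this
    stage \<open>k\<close> might still be infinite.\<close>
  have test: "2 * (\<integral>\<^sup>+x. k x * p x \<partial>M) \<le> G + (\<integral>\<^sup>+x. ennreal ((r x)\<^sup>2) * (p x)\<^sup>2 \<partial>M)"
    if [measurable]: "p \<in> borel_measurable M" for p :: "'a \<Rightarrow> ennreal"
  proof -
    have "2 * (\<integral>\<^sup>+x. k x * p x \<partial>M) = (\<integral>\<^sup>+x. 2 * (ennreal (u x) * p (\<phi> x)) \<partial>M)"
      by (simp add: uk[symmetric] nn_integral_cmult)
    also have "\<dots> \<le> (\<integral>\<^sup>+x. (ennreal (u x))\<^sup>2 + (p (\<phi> x))\<^sup>2 \<partial>M)"
      by (intro nn_integral_mono ennreal_two_mult_le)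
    also have "\<dots> = G + (\<integral>\<^sup>+x. (p (\<phi> x))\<^sup>2 \<partial>M)"
      unfolding G_def by (subst nn_integral_add) (simp_all add: ennreal_power u0)
    also have "(\<integral>\<^sup>+x. (p (\<phi> x))\<^sup>2 \<partial>M) = (\<integral>\<^sup>+x. h_of M \<phi> x * (p x)\<^sup>2 \<partial>M)"
      by (rule nn_integral_comp) simp
    also have "\<dots> = (\<integral>\<^sup>+x. ennreal ((r x)\<^sup>2) * (p x)\<^sup>2 \<partial>M)"
      by (rule nn_integral_cong_AE) (use ennreal_r_square in auto)
    finally show ?thesis .
  qed
  obtain A :: "nat \<Rightarrow> 'a set" where A: "range A \<subseteq> sets M" "(\<Union>i. A i) = space M"
    "\<And>i. emeasure M (A i) \<noteq> \<infinity>" "incseq A"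
    using sigma_finite_incseq by blast
  have [measurable]: "A n \<in> sets M" for n using A(1) by auto
  \<comment> \<open>On A_n \<inter> {r^2 \<le> n} the integrand is at most n n^2, and A_n has finite
    measure.\<close>
  have bounded: "(\<integral>\<^sup>+x. ennreal ((r x)\<^sup>2) * (p x)\<^sup>2 \<partial>M) < \<infinity>"
    if le: "\<And>x. p x \<le> of_nat n * indicator (A n \<inter> {x. (r x)\<^sup>2 \<le> real n}) x"
    for p :: "'a \<Rightarrow> ennreal" and n
  proof -
    have "(\<integral>\<^sup>+x. ennreal ((r x)\<^sup>2) * (p x)\<^sup>2 \<partial>M) \<le> (\<integral>\<^sup>+x. (of_nat n * (of_nat n)\<^sup>2) * indicator (A n) x \<partial>M)"
    proof (rule nn_integral_mono)
      fix x
      show "ennreal ((r x)\<^sup>2) * (p x)\<^sup>2 \<le> (of_nat n * (of_nat n)\<^sup>2) * indicator (A n) x"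
      proof (cases "x \<in> A n \<and> (r x)\<^sup>2 \<le> real n")
        case True
        have "ennreal ((r x)\<^sup>2) \<le> of_nat n"
          using True by (simp add: ennreal_of_nat_eq_real_of_nat ennreal_leI)
        moreover have "(p x)\<^sup>2 \<le> (of_nat n)\<^sup>2"
          using le[of x] True by (intro power_mono) auto
        ultimately show ?thesis using True by (auto intro: mult_mono)
      next
        case False
        then show ?thesis using le[of x] by (auto split: split_indicator)
      qed
    qed
    also have "\<dots> = (of_nat n * (of_nat n)\<^sup>2) * emeasure M (A n)"
      by (rule nn_integral_cmult_indicator) simp
    also have "\<dots> < \<infinity>"
      using A(3)[of n]
      by (simp add: ennreal_mult_less_top less_top power_less_top_ennreal of_nat_less_top)
    finally show ?thesis .
  qed
  have covered: "eventually (\<lambda>n. x \<in> A n \<and> (r x)\<^sup>2 \<le> real n) sequentially" if "x \<in> space M" for x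
  proof (rule eventually_conj)
    from that A(2) obtain i where "x \<in> A i" by blast
    then show "eventually (\<lambda>n. x \<in> A n) sequentially"
      using A(4) by (auto simp: eventually_sequentially incseq_def)
    show "eventually (\<lambda>n. (r x)\<^sup>2 \<le> real n) sequentially"
      using filterlim_real_sequentially unfolding filterlim_at_top by blast
  qed
  \<comment> \<open>n = 0 is excluded because \<open>bounded\<close> asks the indicator to be at
    most n times itself.\<close>
  have "AE x in M. x \<in> A n \<and> (r x)\<^sup>2 \<le> real n \<longrightarrow> k x \<noteq> \<infinity>" if n: "0 < n" for n
  proof -
    define p :: "'a \<Rightarrow> ennreal" where "p = indicator (A n \<inter> {x. (r x)\<^sup>2 \<le> real n})"
    have pM [measurable]: "p \<in> borel_measurable M"
    proof -
      have "(\<lambda>x. if x \<in> A n \<and> (r x)\<^sup>2 \<le> real n then 1 else 0 :: ennreal) \<in> borel_measurable M"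
        by measurable
      then show ?thesis by (rule back_subst[where P = "\<lambda>q. q \<in> borel_measurable M"])
        (auto simp: p_def fun_eq_iff split: split_indicator)
    qed
    have "(\<integral>\<^sup>+x. ennreal ((r x)\<^sup>2) * (p x)\<^sup>2 \<partial>M) < \<infinity>"
      by (rule bounded[of p n]) (use n in \<open>auto simp: p_def split: split_indicator\<close>)
    then have "2 * (\<integral>\<^sup>+x. k x * p x \<partial>M) < \<infinity>"
      using test[OF pM] G by (auto simp: less_top intro: le_less_trans)
    then have "(\<integral>\<^sup>+x. k x * p x \<partial>M) \<noteq> \<infinity>"
      by (auto simp: ennreal_mult_less_top)
    then have "AE x in M. k x * p x \<noteq> \<infinity>" by (intro nn_integral_PInf_AE) auto
    then show ?thesis by eventually_elim (auto simp: p_def split: split_indicator_asm)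
  qed
  then have "AE x in M. \<forall>n. 0 < n \<longrightarrow> x \<in> A n \<and> (r x)\<^sup>2 \<le> real n \<longrightarrow> k x \<noteq> \<infinity>"
    unfolding AE_all_countable by auto
  with AE_space have k_fin: "AE x in M. k x \<noteq> \<infinity>"
  proof eventually_elim
    case (elim x)
    have "eventually (\<lambda>n. 0 < n \<and> x \<in> A n \<and> (r x)\<^sup>2 \<le> real n) sequentially"
      by (rule eventually_conj[OF eventually_gt_at_top covered[OF elim(1)]])
    then obtain n where "0 < n" "x \<in> A n \<and> (r x)\<^sup>2 \<le> real n"
      using eventually_happens'[OF sequentially_bot] by blast
    with elim show ?case by blast
  qed
  \<comment> \<open>Testing with the indicator of {r = 0} shows that \<open>k\<close> vanishes
    there, so the quotient by r^2 loses nothing by the convention for division by 0.\<close>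
  have "(\<integral>\<^sup>+x. k x * indicator {0} (r x) \<partial>M) = (\<integral>\<^sup>+x. ennreal (u x) * indicator {0} (r (\<phi> x)) \<partial>M)"
    by (rule uk[symmetric]) simp
  also have "\<dots> = 0"
    by (subst nn_integral_0_iff_AE) (use r_comp_nonzero in auto)
  finally have k0: "AE x in M. r x = 0 \<longrightarrow> k x = 0"
    by (subst (asm) nn_integral_0_iff_AE) (auto simp: indicator_def)
  define w where "w = (\<lambda>x. enn2real (k x) / (r x)\<^sup>2)"
  have [measurable]: "w \<in> borel_measurable M" unfolding w_def by measurable
  have w0: "0 \<le> w x" for x by (simp add: w_def)
  have kw: "AE x in M. k x = ennreal ((r x)\<^sup>2 * w x)"
    using k_fin k0
  proof eventually_elim
    case (elim x)
    then show ?case by (cases "r x = 0") (auto simp: w_def less_top)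
  qed
  \<comment> \<open>The cutoffs bound the measure of the support, the weight and the quotient, so
    the integral of r^2 q^2 is finite before anything is known about that of r^2 w^2.\<close>
  define q where "q = (\<lambda>n x. if x \<in> A n \<and> (r x)\<^sup>2 \<le> real n \<and> w x \<le> real n then w x else 0)"
  have [measurable]: "q n \<in> borel_measurable M" for n unfolding q_def by measurable
  have q0: "0 \<le> q n x" for n x by (simp add: q_def w0)
  have qG: "(\<integral>\<^sup>+x. ennreal ((r x)\<^sup>2 * (q n x)\<^sup>2) \<partial>M) \<le> G" for n
  proof -
    let ?a = "\<integral>\<^sup>+x. ennreal ((r x)\<^sup>2) * (ennreal (q n x))\<^sup>2 \<partial>M"
    have fin: "?a < \<infinity>"
      by (rule bounded[of _ n])
         (auto simp: q_def ennreal_of_nat_eq_real_of_nat ennreal_leI split: split_indicator)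
    have "(\<integral>\<^sup>+x. k x * ennreal (q n x) \<partial>M) = ?a"
    proof (rule nn_integral_cong_AE)
      show "AE x in M. k x * ennreal (q n x) = ennreal ((r x)\<^sup>2) * (ennreal (q n x))\<^sup>2"
        using kw
        by eventually_elim (auto simp: q_def w0 ennreal_power power2_eq_square mult.assoc simp flip: ennreal_mult)
    qed
    \<comment> \<open>Since k q = r^2 q^2 a.e., the test inequality says 2 a \<le> G + a, and the
      finite a cancels. Fatou's lemma then carries the bound over to \<open>w\<close>.\<close>
    with test[of "\<lambda>x. ennreal (q n x)"] have "?a + ?a \<le> ?a + G"
      by (simp add: mult_2 add.commute)
    then have "?a \<le> G" using fin by (auto simp: ennreal_add_left_cancel_le)
    then show ?thesis by (simp add: ennreal_mult ennreal_power q0)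
  qed
  have "(\<integral>\<^sup>+x. ennreal ((r x)\<^sup>2 * (w x)\<^sup>2) \<partial>M) = (\<integral>\<^sup>+x. liminf (\<lambda>n. ennreal ((r x)\<^sup>2 * (q n x)\<^sup>2)) \<partial>M)"
  proof (rule nn_integral_cong)
    fix x assume x: "x \<in> space M"
    have "eventually (\<lambda>n. w x \<le> real n) sequentially"
      using filterlim_real_sequentially unfolding filterlim_at_top by blast
    with covered[OF x] have "eventually (\<lambda>n. ennreal ((r x)\<^sup>2 * (q n x)\<^sup>2) = ennreal ((r x)\<^sup>2 * (w x)\<^sup>2)) sequentially"
      by eventually_elim (simp add: q_def)
    then show "ennreal ((r x)\<^sup>2 * (w x)\<^sup>2) = liminf (\<lambda>n. ennreal ((r x)\<^sup>2 * (q n x)\<^sup>2))"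
      by (intro lim_imp_Liminf[symmetric] tendsto_eventually) auto
  qed
  also have "\<dots> \<le> liminf (\<lambda>n. \<integral>\<^sup>+x. ennreal ((r x)\<^sup>2 * (q n x)\<^sup>2) \<partial>M)"
    by (rule nn_integral_liminf) simp
  also have "\<dots> \<le> liminf (\<lambda>n. G)"
    by (rule Liminf_mono) (simp add: qG)
  also have "\<dots> = G" by (simp add: Liminf_const)
  finally have wG: "(\<integral>\<^sup>+x. ennreal ((r x)\<^sup>2 * (w x)\<^sup>2) \<partial>M) < \<infinity>" using G by (rule le_less_trans)
  have sq: "square_integrable N (\<lambda>x. complex_of_real (w x))"
    using wG
    by (simp add: square_integrable_h_measure_iff)
       (simp add: square_integrable_def integrable_iff_bounded norm_mult power_mult_distrib)
  have "(\<integral>\<^sup>+x. ennreal (u x) * p (\<phi> x) \<partial>M) = (\<integral>\<^sup>+x. ennreal ((r x)\<^sup>2 * w x) * p x \<partial>M)"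
    if "p \<in> borel_measurable M" for p
    unfolding uk[OF that] by (rule nn_integral_cong_AE) (use kw in auto)
  then have "\<forall>p\<in>borel_measurable M.
      (\<integral>\<^sup>+x. ennreal (u x) * p (\<phi> x) \<partial>M) = (\<integral>\<^sup>+x. ennreal ((r x)\<^sup>2 * w x) * p x \<partial>M)"
    by blast
  moreover have "\<forall>x. 0 \<le> w x" using w0 by blast
  ultimately show thesis by (intro that[OF _ _ sq]) simp_all
qed

text \<open>\<open>w\<close> is V^* g. It is a relation because \<open>w\<close> is determined only
  up to null sets of N, and the pairing is bilinear so that nonnegative functions give nonnegative
  integrals; \<open>comp_adjoint_iff\<close> has the form with conjugates.\<close>

definition comp_adjoint :: "('a \<Rightarrow> complex) \<Rightarrow> ('a \<Rightarrow> complex) \<Rightarrow> bool" where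
  "comp_adjoint g w \<longleftrightarrow> square_integrable N w \<and>
    (\<forall>f. square_integrable N f \<longrightarrow> (LINT x|M. g x * f (\<phi> x)) = (LINT x|N. w x * f x))"

text \<open>Both sides of the pairing are linear in g and in f. The induction for f is nested in the
  nonnegative case for g, which leaves two nonnegative functions and the identity of
  \<open>comp_adjoint_nonneg\<close>.\<close>

lemma comp_adjoint_exists:
  assumes "square_integrable M g"
  shows "\<exists>w. comp_adjoint g w"
  using assms
proof (induction rule: square_integrable_induct)
  case (nonneg u)
  note [measurable] = nonneg(1)
  obtain w where w [measurable]: "w \<in> borel_measurable M" and w0: "\<forall>x. 0 \<le> w x"
    and sq: "square_integrable N (\<lambda>x. complex_of_real (w x))"
    and eq: "\<forall>p\<in>borel_measurable M.
      (\<integral>\<^sup>+x. ennreal (u x) * p (\<phi> x) \<partial>M) = (\<integral>\<^sup>+x. ennreal ((r x)\<^sup>2 * w x) * p x \<partial>M)"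
    by (rule comp_adjoint_nonneg[OF nonneg])
  have "(LINT x|M. complex_of_real (u x) * f (\<phi> x)) = (LINT x|N. complex_of_real (w x) * f x)"
    if "square_integrable N f" for f
    using that
  proof (induction rule: square_integrable_induct)
    case p: (nonneg p)
    have [measurable]: "p \<in> borel_measurable M" using p(1) by simp
    have "(LINT x|M. complex_of_real (u x) * complex_of_real (p (\<phi> x))) = complex_of_real (LINT x|M. u x * p (\<phi> x))"
      by (simp flip: of_real_mult)
    also have "(LINT x|M. u x * p (\<phi> x)) = enn2real (\<integral>\<^sup>+x. ennreal (u x) * ennreal (p (\<phi> x)) \<partial>M)"
      by (subst integral_eq_nn_integral) (simp_all add: nonneg(2) p(2) ennreal_mult)
    also have "\<dots> = enn2real (\<integral>\<^sup>+x. ennreal ((r x)\<^sup>2 * w x) * ennreal (p x) \<partial>M)"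
      by (subst eq[THEN bspec, of "\<lambda>x. ennreal (p x)"]) simp_all
    also have "\<dots> = (LINT x|M. (r x)\<^sup>2 * w x * p x)"
      by (subst integral_eq_nn_integral) (simp_all add: w0 p(2) ennreal_mult)
    also have "complex_of_real \<dots> = (LINT x|N. complex_of_real (w x) * complex_of_real (p x))"
      by (subst integral_h_measure) (simp_all add: mult.assoc flip: of_real_mult of_real_power)
    finally show ?case .
  next
    case (add f g)
    have "square_integrable M (f \<circ> \<phi>)" "square_integrable M (g \<circ> \<phi>)"
      using add(1,2) by (simp_all add: square_integrable_comp_iff square_integrable_h_measure_measurable)
    then have "integrable M (\<lambda>x. complex_of_real (u x) * f (\<phi> x))" "integrable M (\<lambda>x. complex_of_real (u x) * g (\<phi> x))"
      using integrable_square_integrable_mult[OF nonneg(3)] by (auto simp: o_def)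
    moreover have "integrable N (\<lambda>x. complex_of_real (w x) * f x)" "integrable N (\<lambda>x. complex_of_real (w x) * g x)"
      using integrable_square_integrable_mult[OF sq] add(1,2) by auto
    ultimately show ?case using add(3,4) by (simp add: distrib_left)
  next
    case (scale c f)
    then show ?case by (simp add: mult.left_commute[of _ c])
  qed
  with sq show ?case unfolding comp_adjoint_def by blast
next
  case (add g1 g2)
  then obtain w1 w2 where w: "comp_adjoint g1 w1" "comp_adjoint g2 w2" by blast
  have "comp_adjoint (\<lambda>x. g1 x + g2 x) (\<lambda>x. w1 x + w2 x)"
    unfolding comp_adjoint_def
  proof (intro conjI allI impI)
    show "square_integrable N (\<lambda>x. w1 x + w2 x)"
      using w by (auto simp: comp_adjoint_def intro: square_integrable_add)
    fix f assume f: "square_integrable N f"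
    then have "square_integrable M (f \<circ> \<phi>)"
      by (simp add: square_integrable_comp_iff square_integrable_h_measure_measurable)
    then have "integrable M (\<lambda>x. g1 x * f (\<phi> x))" "integrable M (\<lambda>x. g2 x * f (\<phi> x))"
      using integrable_square_integrable_mult[OF add(1)] integrable_square_integrable_mult[OF add(2)]
      by (auto simp: o_def)
    moreover have "integrable N (\<lambda>x. w1 x * f x)" "integrable N (\<lambda>x. w2 x * f x)"
      using w f by (auto simp: comp_adjoint_def intro: integrable_square_integrable_mult)
    ultimately show "(LINT x|M. (g1 x + g2 x) * f (\<phi> x)) = (LINT x|N. (w1 x + w2 x) * f x)"
      using w f by (simp add: comp_adjoint_def distrib_right)
  qed
  then show ?case by blast
next
  case (scale c g)
  then obtain w where "comp_adjoint g w" by blast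
  then have "comp_adjoint (\<lambda>x. c * g x) (\<lambda>x. c * w x)"
    by (auto simp: comp_adjoint_def mult.assoc intro: square_integrable_scale)
  then show ?case by blast
qed

section \<open>Closures of the ranges and the kernel\<close>

definition comp_range :: "('a \<Rightarrow> complex) set set" where
  "comp_range = {ae_class M (f \<circ> \<phi>) | f. square_integrable N f}"

definition weighted_range :: "('a \<Rightarrow> complex) set set" where
  "weighted_range = {ae_class M (\<lambda>x. complex_of_real (r x) * f x) | f. square_integrable N f}"

lemma square_integrable_compI:
  "square_integrable N f \<Longrightarrow> square_integrable M (f \<circ> \<phi>)"
  by (simp add: square_integrable_comp_iff square_integrable_h_measure_measurable)

lemma square_integrable_weightI:
  "square_integrable N f \<Longrightarrow> square_integrable M (\<lambda>x. complex_of_real (r x) * f x)"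
  using square_integrable_h_measure_iff square_integrable_h_measure_measurable by blast

text \<open>Where r = 0 the quotient is 0 by convention, so r (f / r) is the restriction of f to {r
  \<noteq> 0}.\<close>

lemma square_integrable_divide_r:
  assumes f: "square_integrable M f"
  shows "square_integrable N (\<lambda>x. f x / complex_of_real (r x))"
proof -
  note [measurable] = square_integrable_measurable[OF f]
  have "square_integrable M (\<lambda>x. complex_of_real (r x) * (f x / complex_of_real (r x)))"
    by (rule square_integrable_bound(1)[OF f, where c = 1]) auto
  then show ?thesis by (simp add: square_integrable_h_measure_iff)
qed

lemma eventually_lower_truncation:
  assumes "r x \<noteq> 0"
  shows "eventually (\<lambda>n. 1 \<le> real n * r x) sequentially"
proof -
  have pos: "0 < r x" using assms r_nonneg[of x] by linarith
  have "eventually (\<lambda>n. 1 / r x \<le> real n) sequentially"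
    using filterlim_real_sequentially unfolding filterlim_at_top by blast
  then show ?thesis by eventually_elim (use pos in \<open>simp add: field_simps\<close>)
qed

text \<open>On {r \<ge> 1/n} one has |f| \<le> n r |f|, and r f lies in L^2(\<mu>). Without a
  division, the condition simply fails for n = 0.\<close>

lemma square_integrable_lower_truncation:
  assumes f: "square_integrable N f"
  shows "square_integrable M (\<lambda>x. if 1 \<le> real n * r x then f x else 0)"
proof -
  note [measurable] = square_integrable_h_measure_measurable[OF f]
  have "cmod (if 1 \<le> real n * r x then f x else 0) \<le> real n * cmod (complex_of_real (r x) * f x)" for x
    using mult_right_mono[of 1 "real n * r x" "cmod (f x)"] by (auto simp: norm_mult mult.assoc)
  then show ?thesis
    by (intro square_integrable_bound(1)[OF square_integrable_weightI[OF f], where c = "real n"]) auto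
qed

lemma lower_truncation_tendsto:
  assumes f: "square_integrable N f"
  shows "(\<lambda>n. sqnorm N (\<lambda>x. f x - (if 1 \<le> real n * r x then f x else 0))) \<longlonglongrightarrow> 0"
proof (rule sqnorm_truncation_tendsto_0[OF f])
  show "AE x in N. f x \<noteq> 0 \<longrightarrow> (\<forall>\<^sub>F n in sequentially. 1 \<le> real n * r x)"
    unfolding AE_h_measure by (auto intro: eventually_lower_truncation)
qed measurable

text \<open>The L^2(\<mu>)-norm of r (f - f_n) is the L^2(N)-norm of f - f_n, and the truncations
  converge in L^2(N) because r is nonzero N-almost everywhere.\<close>

lemma weighted_range_subset_closure:
  "weighted_range \<subseteq> vclosure (L2 M) (Range (mult_op M (\<lambda>x. complex_of_real (r x))))"
proof
  fix F assume "F \<in> weighted_range"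
  then obtain f where f: "square_integrable N f" and F: "F = ae_class M (\<lambda>x. complex_of_real (r x) * f x)"
    by (auto simp: weighted_range_def)
  note [measurable] = square_integrable_h_measure_measurable[OF f]
  let ?f = "\<lambda>n x. if 1 \<le> real n * r x then f x else 0"
  have rf: "square_integrable M (\<lambda>x. complex_of_real (r x) * ?f n x)" for n
    by (rule square_integrable_bound(1)[OF square_integrable_weightI[OF f], where c = 1]) auto
  have "(ae_class M (?f n), ae_class M (\<lambda>x. complex_of_real (r x) * ?f n x)) \<in> mult_op M (\<lambda>x. complex_of_real (r x))" for n
    by (subst mult_op_iff) (use square_integrable_lower_truncation[OF f] rf in simp_all)
  then have rng: "ae_class M (\<lambda>x. complex_of_real (r x) * ?f n x) \<in> Range (mult_op M (\<lambda>x. complex_of_real (r x)))" for n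
    by blast
  have "sqnorm N (\<lambda>x. f x - ?f n x)
      = sqnorm M (\<lambda>x. complex_of_real (r x) * f x - complex_of_real (r x) * ?f n x)" for n
    by (subst sqnorm_h_measure) (simp_all only: right_diff_distrib, measurable)
  with lower_truncation_tendsto[OF f]
  have "(\<lambda>n. sqnorm M (\<lambda>x. complex_of_real (r x) * f x - complex_of_real (r x) * ?f n x)) \<longlonglongrightarrow> 0"
    by simp
  then show "F \<in> vclosure (L2 M) (Range (mult_op M (\<lambda>x. complex_of_real (r x))))"
    unfolding F by (intro vclosure_L2I[OF square_integrable_weightI[OF f] rng]) measurable
qed

lemma comp_range_subset_closure:
  "comp_range \<subseteq> vclosure (L2 M) (Range (comp_op M \<phi>))"
proof
  fix F assume "F \<in> comp_range"
  then obtain f where f: "square_integrable N f" and F: "F = ae_class M (f \<circ> \<phi>)"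
    by (auto simp: comp_range_def)
  note [measurable] = square_integrable_h_measure_measurable[OF f]
  let ?f = "\<lambda>n x. if 1 \<le> real n * r x then f x else 0"
  have "square_integrable N (?f n)" for n
    by (rule square_integrable_restrict[OF f]) measurable
  then have "square_integrable M (?f n \<circ> \<phi>)" for n
    by (rule square_integrable_compI)
  then have "(ae_class M (?f n), ae_class M (?f n \<circ> \<phi>)) \<in> comp_op M \<phi>" for n
    by (subst comp_op_iff) (use square_integrable_lower_truncation[OF f] in simp_all)
  then have rng: "ae_class M (?f n \<circ> \<phi>) \<in> Range (comp_op M \<phi>)" for n by blast
  have "sqnorm N (\<lambda>x. f x - ?f n x) = sqnorm M (\<lambda>x. (f \<circ> \<phi>) x - (?f n \<circ> \<phi>) x)" for n
    using sqnorm_comp[of "\<lambda>x. f x - ?f n x"] by (simp add: o_def)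
  with lower_truncation_tendsto[OF f]
  have "(\<lambda>n. sqnorm M (\<lambda>x. (f \<circ> \<phi>) x - (?f n \<circ> \<phi>) x)) \<longlonglongrightarrow> 0" by simp
  then show "F \<in> vclosure (L2 M) (Range (comp_op M \<phi>))"
    unfolding F by (intro vclosure_L2I[OF square_integrable_compI[OF f] rng]) measurable
qed

lemma comp_adjoint_iff:
  "comp_adjoint g w \<longleftrightarrow> square_integrable N w \<and>
    (\<forall>f. square_integrable N f \<longrightarrow> (LINT x|M. g x * cnj (f (\<phi> x))) = (LINT x|N. w x * cnj (f x)))"
  unfolding comp_adjoint_def
proof (intro conj_cong refl iffI allI impI)
  fix f assume "square_integrable N f"
  then have cf: "square_integrable N (\<lambda>x. cnj (f x))" by (rule square_integrable_cnj)
  show "(LINT x|M. g x * cnj (f (\<phi> x))) = (LINT x|N. w x * cnj (f x))"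
    if "\<forall>f. square_integrable N f \<longrightarrow> (LINT x|M. g x * f (\<phi> x)) = (LINT x|N. w x * f x)"
    using that[rule_format, OF cf] .
  show "(LINT x|M. g x * f (\<phi> x)) = (LINT x|N. w x * f x)"
    if "\<forall>f. square_integrable N f \<longrightarrow> (LINT x|M. g x * cnj (f (\<phi> x))) = (LINT x|N. w x * cnj (f x))"
    using that[rule_format, OF cf] by simp
qed

text \<open>V is isometric, so pairing w with f in L^2(N) is pairing w \<circ> \<phi> with f \<circ>
  \<phi> in L^2(\<mu>). Thus w \<circ> \<phi> is the orthogonal projection of g.\<close>

lemma comp_adjoint_iff_orthogonal:
  assumes g: "square_integrable M g" and w: "square_integrable N w"
  shows "comp_adjoint g w \<longleftrightarrow> ae_class M (\<lambda>x. g x - (w \<circ> \<phi>) x) \<in> orth_compl (L2 M) comp_range"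
proof -
  note wphi = square_integrable_compI[OF w]
  note [measurable] = square_integrable_measurable[OF g] square_integrable_h_measure_measurable[OF w]
  have "cinner (L2 M) (ae_class M (\<lambda>x. g x - (w \<circ> \<phi>) x)) (ae_class M (f \<circ> \<phi>))
      = (LINT x|M. g x * cnj (f (\<phi> x))) - (LINT x|N. w x * cnj (f x))"
    if f: "square_integrable N f" for f
  proof -
    note [measurable] = square_integrable_h_measure_measurable[OF f]
    have "(LINT x|N. w x * cnj (f x)) = (LINT x|M. w (\<phi> x) * cnj (f (\<phi> x)))"
      by (rule integral_comp[symmetric]) measurable
    then show ?thesis
      using integrable_mult_cnj[OF g square_integrable_compI[OF f]]
        integrable_mult_cnj[OF wphi square_integrable_compI[OF f]]
      by (simp add: cinner_L2 left_diff_distrib)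
  qed
  then show ?thesis
    using w square_integrable_diff[OF g wphi]
    by (auto simp: comp_adjoint_iff orth_compl_def comp_range_def)
qed

text \<open>For g in the closure, d = g - w \<circ> \<phi> is orthogonal to
  \<open>comp_range\<close>, hence to the range of C and to its closure. So d is orthogonal to g and
  to w \<circ> \<phi>, and therefore to itself.\<close>

lemma closure_comp_range: "vclosure (L2 M) (Range (comp_op M \<phi>)) = comp_range"
proof (rule equalityI[OF _ comp_range_subset_closure])
  show "vclosure (L2 M) (Range (comp_op M \<phi>)) \<subseteq> comp_range"
  proof
    fix F assume F: "F \<in> vclosure (L2 M) (Range (comp_op M \<phi>))"
    then obtain g where g: "square_integrable M g" "F = ae_class M g"
      by (auto simp: vclosure_def elim: vecs_L2E)
    obtain w where w: "comp_adjoint g w" using comp_adjoint_exists[OF g(1)] by blast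
    then have wN: "square_integrable N w" by (simp add: comp_adjoint_def)
    note wphi = square_integrable_compI[OF wN]
    note [measurable] = square_integrable_measurable[OF g(1)] square_integrable_measurable[OF wphi]
    define d where "d = (\<lambda>x. g x - (w \<circ> \<phi>) x)"
    have d: "square_integrable M d" unfolding d_def by (rule square_integrable_diff[OF g(1) wphi])
    note [measurable] = square_integrable_measurable[OF d]
    have orth: "ae_class M d \<in> orth_compl (L2 M) comp_range"
      using w comp_adjoint_iff_orthogonal[OF g(1) wN] by (simp add: d_def)
    have perp: "(LINT x|M. f (\<phi> x) * cnj (d x)) = 0" if f: "square_integrable N f" for f
    proof -
      note [measurable] = square_integrable_h_measure_measurable[OF f]
      have "(LINT x|M. d x * cnj (f (\<phi> x))) = 0"
        using orth f by (auto simp: orth_compl_def comp_range_def cinner_L2)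
      moreover have "(LINT x|M. f (\<phi> x) * cnj (d x)) = (LINT x|M. cnj (d x * cnj (f (\<phi> x))))"
        by (simp add: mult.commute)
      moreover have "\<dots> = cnj (LINT x|M. d x * cnj (f (\<phi> x)))" by (rule Bochner_Integration.integral_cnj)
      ultimately show ?thesis by simp
    qed
    have "Range (comp_op M \<phi>) \<subseteq> orth_compl (L2 M) {ae_class M d}"
    proof clarify
      fix X Y assume "(X, Y) \<in> comp_op M \<phi>"
      then obtain f where f: "square_integrable M f" "square_integrable M (f \<circ> \<phi>)" "Y = ae_class M (f \<circ> \<phi>)"
        by (rule comp_opE)
      note [measurable] = square_integrable_measurable[OF f(1)]
      have "square_integrable N f" using f(2) by (simp add: square_integrable_comp_iff)
      from perp[OF this] f show "Y \<in> orth_compl (L2 M) {ae_class M d}"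
        by (simp add: orth_compl_def cinner_L2)
    qed
    from vclosure_subset_orth_compl[OF this] d F have "F \<in> orth_compl (L2 M) {ae_class M d}" by auto
    then have gd: "(LINT x|M. g x * cnj (d x)) = 0"
      by (simp add: orth_compl_def g(2) cinner_L2)
    have "complex_of_real (sqnorm M d) = (LINT x|M. g x * cnj (d x) - w (\<phi> x) * cnj (d x))"
      by (simp add: integral_mult_cnj_self[symmetric] d_def left_diff_distrib)
    also have "\<dots> = 0"
      using integrable_mult_cnj[OF g(1) d] integrable_mult_cnj[OF wphi d] gd perp[OF wN] by simp
    finally have "AE x in M. d x = 0" using sqnorm_eq_0_iff[OF d] by simp
    then have "AE x in M. g x = (w \<circ> \<phi>) x" by eventually_elim (simp add: d_def)
    then have "F = ae_class M (w \<circ> \<phi>)" unfolding g(2) by (rule ae_class_cong)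
    with wN show "F \<in> comp_range" by (auto simp: comp_range_def)
  qed
qed

lemma op_kernel_comp_op:
  "op_kernel (L2 M) (comp_op M \<phi>)
    = {ae_class M f | f. square_integrable M f \<and> (AE x in M. r x \<noteq> 0 \<longrightarrow> f x = 0)}"
proof (intro set_eqI iffI)
  fix F assume "F \<in> op_kernel (L2 M) (comp_op M \<phi>)"
  then have "(F, ae_class M (\<lambda>x. 0)) \<in> comp_op M \<phi>" by (simp add: op_kernel_def vzero_L2)
  then obtain f where f: "square_integrable M f" "square_integrable M (f \<circ> \<phi>)" "F = ae_class M f"
    and eq: "ae_class M (\<lambda>x. 0) = ae_class M (f \<circ> \<phi>)" by (rule comp_opE)
  note [measurable] = square_integrable_measurable[OF f(1)]
  have fN: "square_integrable N f" using f(2) by (simp add: square_integrable_comp_iff)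
  from eq have "AE x in M. (f \<circ> \<phi>) x = 0" by (subst (asm) ae_class_eq_iff) auto
  then have "sqnorm N f = 0"
    using sqnorm_eq_0_iff[OF f(2)] by (simp add: sqnorm_comp)
  then have "AE x in M. r x \<noteq> 0 \<longrightarrow> f x = 0"
    using sqnorm_eq_0_iff[OF fN] by (simp add: AE_h_measure)
  with f show "F \<in> {ae_class M f | f. square_integrable M f \<and> (AE x in M. r x \<noteq> 0 \<longrightarrow> f x = 0)}"
    by blast
next
  fix F assume "F \<in> {ae_class M f | f. square_integrable M f \<and> (AE x in M. r x \<noteq> 0 \<longrightarrow> f x = 0)}"
  then obtain f where f: "square_integrable M f" "F = ae_class M f" and ae: "AE x in M. r x \<noteq> 0 \<longrightarrow> f x = 0"
    by blast
  note [measurable] = square_integrable_measurable[OF f(1)]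
  from ae have "AE x in M. f (\<phi> x) = 0" by (intro AE_comp) (simp add: AE_h_measure)
  then have ae': "AE x in M. (f \<circ> \<phi>) x = 0" by simp
  then have "square_integrable M (f \<circ> \<phi>)"
    by (intro square_integrable_cong_AE[OF square_integrable_zero]) auto
  with f have "(F, ae_class M (f \<circ> \<phi>)) \<in> comp_op M \<phi>" by (simp add: comp_op_iff)
  with ae_class_cong[OF ae'] show "F \<in> op_kernel (L2 M) (comp_op M \<phi>)"
    by (simp add: op_kernel_def vzero_L2 o_def)
qed

text \<open>The restriction of f to {r = 0} belongs to the kernel. Orthogonality to it forces f to
  vanish there, and then f = r (f / r) a.e.\<close>

lemma orth_compl_kernel_subset:
  "orth_compl (L2 M) (op_kernel (L2 M) (comp_op M \<phi>)) \<subseteq> weighted_range"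
proof
  fix F assume F: "F \<in> orth_compl (L2 M) (op_kernel (L2 M) (comp_op M \<phi>))"
  then obtain f where f: "square_integrable M f" "F = ae_class M f"
    by (auto simp: orth_compl_def elim: vecs_L2E)
  note [measurable] = square_integrable_measurable[OF f(1)]
  define z where "z = (\<lambda>x. if r x = 0 then f x else 0)"
  have z: "square_integrable M z" unfolding z_def by (rule square_integrable_restrict[OF f(1)]) measurable
  note [measurable] = square_integrable_measurable[OF z]
  have "ae_class M z \<in> op_kernel (L2 M) (comp_op M \<phi>)"
    unfolding op_kernel_comp_op using z by (auto simp: z_def)
  with F have "(LINT x|M. f x * cnj (z x)) = 0"
    by (auto simp: orth_compl_def f(2) cinner_L2)
  also have "(LINT x|M. f x * cnj (z x)) = (LINT x|M. z x * cnj (z x))"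
    by (rule Bochner_Integration.integral_cong) (auto simp: z_def)
  finally have "sqnorm M z = 0" by (simp add: integral_mult_cnj_self)
  then have "AE x in M. z x = 0" by (simp add: sqnorm_eq_0_iff[OF z])
  then have "AE x in M. f x = complex_of_real (r x) * (f x / complex_of_real (r x))"
    by eventually_elim (auto simp: z_def split: if_splits)
  then have "F = ae_class M (\<lambda>x. complex_of_real (r x) * (f x / complex_of_real (r x)))"
    unfolding f(2) by (rule ae_class_cong)
  then show "F \<in> weighted_range"
    unfolding weighted_range_def using square_integrable_divide_r[OF f(1)]
    by (intro CollectI exI conjI)
qed

lemma closure_range_subset_orth_compl_kernel:
  "vclosure (L2 M) (Range (mult_op M (\<lambda>x. complex_of_real (r x))))
    \<subseteq> orth_compl (L2 M) (op_kernel (L2 M) (comp_op M \<phi>))"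
proof (rule vclosure_subset_orth_compl)
  show "op_kernel (L2 M) (comp_op M \<phi>) \<subseteq> vecs (L2 M)"
    by (auto simp: op_kernel_comp_op)
  show "Range (mult_op M (\<lambda>x. complex_of_real (r x))) \<subseteq> orth_compl (L2 M) (op_kernel (L2 M) (comp_op M \<phi>))"
  proof clarify
    fix X Y assume "(X, Y) \<in> mult_op M (\<lambda>x. complex_of_real (r x))"
    then obtain f where f: "square_integrable M f" "square_integrable M (\<lambda>x. complex_of_real (r x) * f x)"
      "Y = ae_class M (\<lambda>x. complex_of_real (r x) * f x)" by (rule mult_opE)
    note [measurable] = square_integrable_measurable[OF f(1)]
    have "cinner (L2 M) Y G = 0" if G: "G \<in> op_kernel (L2 M) (comp_op M \<phi>)" for G
    proof -
      from G obtain g where g: "square_integrable M g" "G = ae_class M g"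
        and ae: "AE x in M. r x \<noteq> 0 \<longrightarrow> g x = 0"
        unfolding op_kernel_comp_op by blast
      note [measurable] = square_integrable_measurable[OF g(1)]
      have "(LINT x|M. complex_of_real (r x) * f x * cnj (g x)) = 0"
        by (rule integral_eq_zero_AE) (use ae in auto)
      then show ?thesis by (simp add: f(3) g(2) cinner_L2)
    qed
    with f show "Y \<in> orth_compl (L2 M) (op_kernel (L2 M) (comp_op M \<phi>))"
      by (auto simp: orth_compl_def)
  qed
qed

text \<open>The complement of the kernel lies in \<open>weighted_range\<close>, this in the closure
  of the range of the modulus, and this again in the complement. The cycle makes all three equal,
  here and in \<open>closure_range_abs\<close>.\<close>

lemma orth_compl_kernel:
  "orth_compl (L2 M) (op_kernel (L2 M) (comp_op M \<phi>)) = weighted_range"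
  using orth_compl_kernel_subset weighted_range_subset_closure closure_range_subset_orth_compl_kernel
  by blast

lemma closure_range_abs:
  "vclosure (L2 M) (Range (mult_op M (\<lambda>x. complex_of_real (r x)))) = weighted_range"
  using orth_compl_kernel_subset weighted_range_subset_closure closure_range_subset_orth_compl_kernel
  by blast

section \<open>The unitary V and the projection\<close>

lemma comp_unitary_iff:
  assumes f [measurable]: "f \<in> borel_measurable M"
  shows "(ae_class N f, G) \<in> comp_unitary M \<phi> \<longleftrightarrow> square_integrable N f \<and> G = ae_class M (f \<circ> \<phi>)"
proof
  assume "(ae_class N f, G) \<in> comp_unitary M \<phi>"
  then obtain f' where f': "square_integrable N f'" and eq: "ae_class N f = ae_class N f'" "G = ae_class M (f' \<circ> \<phi>)"
    by (auto simp: comp_unitary_def)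
  from eq(1) have ae: "AE x in N. f x = f' x" by (subst (asm) ae_class_eq_iff) auto
  then have ae': "AE x in M. (f \<circ> \<phi>) x = (f' \<circ> \<phi>) x" by (auto dest: AE_comp)
  have "square_integrable N f" by (rule square_integrable_cong_AE[OF f' _ ae]) simp
  then show "square_integrable N f \<and> G = ae_class M (f \<circ> \<phi>)"
    using eq(2) ae_class_cong[OF ae'] by (simp add: o_def)
qed (auto simp: comp_unitary_def)

lemma comp_unitaryE:
  assumes "(F, G) \<in> comp_unitary M \<phi>"
  obtains f where "square_integrable N f" "F = ae_class N f" "G = ae_class M (f \<circ> \<phi>)"
  using assms by (auto simp: comp_unitary_def)

text \<open>Only the carrier of \<open>L2 M\<close> is shrunk; its operations and inner product
  remain. Surjectivity is then immediate, and isometry is the change of variables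
  \<open>integral_comp\<close>.\<close>

lemma unitary_comp_unitary:
  "unitary_op (L2 N) ((L2 M)\<lparr>vecs := comp_range\<rparr>) (comp_unitary M \<phi>)"
  unfolding unitary_op_def
proof (intro conjI)
  show "Domain (comp_unitary M \<phi>) = vecs (L2 N)"
    by (auto simp: comp_unitary_def vecs_L2)
  show "Range (comp_unitary M \<phi>) = vecs ((L2 M)\<lparr>vecs := comp_range\<rparr>)"
    by (auto simp: comp_unitary_def comp_range_def)
  show "\<forall>(F, G)\<in>comp_unitary M \<phi>. \<forall>(F', G')\<in>comp_unitary M \<phi>.
      cinner ((L2 M)\<lparr>vecs := comp_range\<rparr>) G G' = cinner (L2 N) F F'"
  proof clarify
    fix F G F' G' assume "(F, G) \<in> comp_unitary M \<phi>" "(F', G') \<in> comp_unitary M \<phi>"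
    then obtain f f' where f: "square_integrable N f" "F = ae_class N f" "G = ae_class M (f \<circ> \<phi>)"
      and f': "square_integrable N f'" "F' = ae_class N f'" "G' = ae_class M (f' \<circ> \<phi>)"
      by (auto elim!: comp_unitaryE)
    note [measurable] = square_integrable_h_measure_measurable[OF f(1)] square_integrable_h_measure_measurable[OF f'(1)]
    show "cinner ((L2 M)\<lparr>vecs := comp_range\<rparr>) G G' = cinner (L2 N) F F'"
      using integral_comp[of "\<lambda>x. f x * cnj (f' x)"] by (simp add: f f' cinner_L2)
  qed
  show "linear_op (L2 N) ((L2 M)\<lparr>vecs := comp_range\<rparr>) (comp_unitary M \<phi>)"
    unfolding linear_op_def
  proof (intro conjI allI impI)
    show "comp_unitary M \<phi> \<subseteq> vecs (L2 N) \<times> vecs ((L2 M)\<lparr>vecs := comp_range\<rparr>)"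
      by (auto simp: comp_unitary_def comp_range_def)
    show "single_valued (comp_unitary M \<phi>)"
    proof (rule single_valuedI)
      fix F G H assume "(F, G) \<in> comp_unitary M \<phi>" and FH: "(F, H) \<in> comp_unitary M \<phi>"
      then obtain f where f: "square_integrable N f" "F = ae_class N f" "G = ae_class M (f \<circ> \<phi>)"
        by (auto elim: comp_unitaryE)
      from FH show "G = H"
        by (simp add: f comp_unitary_iff square_integrable_h_measure_measurable)
    qed
    show "(vzero (L2 N), vzero ((L2 M)\<lparr>vecs := comp_range\<rparr>)) \<in> comp_unitary M \<phi>"
      by (simp add: vzero_L2 comp_unitary_iff o_def)
  next
    fix F G F' G' assume "(F, G) \<in> comp_unitary M \<phi>" "(F', G') \<in> comp_unitary M \<phi>"
    then obtain f f' where f: "square_integrable N f" "F = ae_class N f" "G = ae_class M (f \<circ> \<phi>)"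
      and f': "square_integrable N f'" "F' = ae_class N f'" "G' = ae_class M (f' \<circ> \<phi>)"
      by (auto elim!: comp_unitaryE)
    note [measurable] = square_integrable_h_measure_measurable[OF f(1)] square_integrable_h_measure_measurable[OF f'(1)]
    show "(vadd (L2 N) F F', vadd ((L2 M)\<lparr>vecs := comp_range\<rparr>) G G') \<in> comp_unitary M \<phi>"
      using square_integrable_add[OF f(1) f'(1)]
      by (simp add: f f' vadd_L2 comp_unitary_iff o_def)
  next
    fix c F G assume "(F, G) \<in> comp_unitary M \<phi>"
    then obtain f where f: "square_integrable N f" "F = ae_class N f" "G = ae_class M (f \<circ> \<phi>)"
      by (auto elim: comp_unitaryE)
    note [measurable] = square_integrable_h_measure_measurable[OF f(1)]
    show "(vscale (L2 N) c F, vscale ((L2 M)\<lparr>vecs := comp_range\<rparr>) c G) \<in> comp_unitary M \<phi>"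
      using square_integrable_scale[OF f(1), of c]
      by (simp add: f vscale_L2 comp_unitary_iff o_def)
  qed
qed

text \<open>The relational composition is V^{-1} P, and \<open>w\<close> ranges over the
  representatives of its value. That these are the functions \<open>comp_adjoint\<close> relates to
  g is the projection property in \<open>comp_adjoint_iff_orthogonal\<close>.\<close>

lemma projection_comp_unitary_iff:
  "(G, F) \<in> orth_projection (L2 M) comp_range O (comp_unitary M \<phi>)\<inverse> \<and> w \<in> F \<longleftrightarrow>
    (\<exists>g. square_integrable M g \<and> G = ae_class M g \<and> comp_adjoint g w \<and> F = ae_class N w)"
proof (intro iffI; elim conjE exE)
  assume GF: "(G, F) \<in> orth_projection (L2 M) comp_range O (comp_unitary M \<phi>)\<inverse>" and wF: "w \<in> F"
  then obtain Y where GY: "(G, Y) \<in> orth_projection (L2 M) comp_range" and FY: "(F, Y) \<in> comp_unitary M \<phi>"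
    by blast
  from GY obtain g where g: "square_integrable M g" "G = ae_class M g"
    by (auto simp: orth_projection_def elim: vecs_L2E)
  from FY obtain f where f: "square_integrable N f" "F = ae_class N f" by (rule comp_unitaryE)
  from wF have wM [measurable]: "w \<in> borel_measurable M" and ae: "AE x in N. w x = f x"
    by (auto simp: f(2) ae_class_iff)
  have F: "F = ae_class N w" unfolding f(2) using ae_class_cong[OF ae] ..
  from FY have w: "square_integrable N w" and Y: "Y = ae_class M (w \<circ> \<phi>)"
    by (simp_all add: F comp_unitary_iff)
  note [measurable] = square_integrable_measurable[OF g(1)]
  have "comp_adjoint g w"
    using GY unfolding comp_adjoint_iff_orthogonal[OF g(1) w]
    by (simp add: orth_projection_def g(2) Y vdiff_L2)
  with g F show "\<exists>g. square_integrable M g \<and> G = ae_class M g \<and> comp_adjoint g w \<and> F = ae_class N w"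
    by blast
next
  fix g assume g: "square_integrable M g" "G = ae_class M g" and gw: "comp_adjoint g w" and F: "F = ae_class N w"
  from gw have w: "square_integrable N w" by (simp add: comp_adjoint_def)
  note [measurable] = square_integrable_measurable[OF g(1)] square_integrable_h_measure_measurable[OF w]
  have "(G, ae_class M (w \<circ> \<phi>)) \<in> orth_projection (L2 M) comp_range"
    using gw w g unfolding comp_adjoint_iff_orthogonal[OF g(1) w]
    by (auto simp: orth_projection_def vdiff_L2 comp_range_def)
  moreover have "(F, ae_class M (w \<circ> \<phi>)) \<in> comp_unitary M \<phi>"
    using w by (simp add: F comp_unitary_iff)
  moreover have "w \<in> F" by (simp add: F ae_class_iff)
  ultimately show "(G, F) \<in> orth_projection (L2 M) comp_range O (comp_unitary M \<phi>)\<inverse> \<and> w \<in> F"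
    by blast
qed

text \<open>This is V applied to g / r. A function supported in {r = 0} is sent to 0 by the
  convention for division, as it must be for an element of the kernel.\<close>

definition polar_map :: "('a \<Rightarrow> complex) \<Rightarrow> 'a \<Rightarrow> complex" where
  "polar_map g = (\<lambda>x. g x / complex_of_real (r x)) \<circ> \<phi>"

lemma square_integrable_polar_map:
  "square_integrable M g \<Longrightarrow> square_integrable M (polar_map g)"
  unfolding polar_map_def by (intro square_integrable_compI square_integrable_divide_r)

text \<open>V preserves norms, and r (g / r) is g cut down to {r \<noteq> 0}; the part of g on {r =
  0} is lost.\<close>

lemma sqnorm_polar_map_le:
  assumes g: "square_integrable M g"
  shows "sqnorm M (polar_map g) \<le> sqnorm M g"
proof -
  note [measurable] = square_integrable_measurable[OF g]
  have "sqnorm M (polar_map g) = sqnorm M (\<lambda>x. complex_of_real (r x) * (g x / complex_of_real (r x)))"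
    unfolding polar_map_def by (simp add: sqnorm_comp sqnorm_h_measure)
  also have "\<dots> \<le> 1\<^sup>2 * sqnorm M g"
    by (rule square_integrable_bound(2)[OF g]) auto
  finally show ?thesis by simp
qed

end

section \<open>The polar decomposition\<close>

locale polar_composition = nonsingular_composition M \<phi> for M :: "'a measure" and \<phi> +
  fixes U :: "(('a \<Rightarrow> complex) set \<times> ('a \<Rightarrow> complex) set) set"
  assumes polar: "polar_decomposition (L2 M) (L2 M) (comp_op M \<phi>) U"
begin

lemma
  shows bounded_U: "bounded_op (L2 M) (L2 M) U"
    and comp_op_eq: "comp_op M \<phi> = mult_op M (\<lambda>x. complex_of_real (r x)) O U"
    and kernel_U: "op_kernel (L2 M) U = op_kernel (L2 M) (comp_op M \<phi>)"
  using polar by (auto simp: polar_decomposition_def partial_isometry_def abs_comp_op)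

lemma linear_U: "linear_op (L2 M) (L2 M) U"
  using bounded_U by (simp add: bounded_op_def)

lemma Domain_U: "Domain U = vecs (L2 M)"
  using bounded_U by (simp add: bounded_op_def)

lemma U_unique: "(F, G) \<in> U \<Longrightarrow> (F, H) \<in> U \<Longrightarrow> G = H"
  using linear_U by (auto simp: linear_op_def single_valued_def)

lemma U_value:
  assumes g: "square_integrable M g"
  obtains k where "square_integrable M k" "(ae_class M g, ae_class M k) \<in> U"
proof -
  from g Domain_U obtain K where K: "(ae_class M g, K) \<in> U"
    using ae_class_in_vecs[OF g] by blast
  then have "K \<in> vecs (L2 M)" using linear_U by (auto simp: linear_op_def)
  with K show thesis using that by (auto elim: vecs_L2E)
qed

lemma U_add:
  assumes "(ae_class M f, ae_class M g) \<in> U" "(ae_class M f', ae_class M g') \<in> U"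
    and [measurable]: "f \<in> borel_measurable M" "g \<in> borel_measurable M" "f' \<in> borel_measurable M" "g' \<in> borel_measurable M"
  shows "(ae_class M (\<lambda>x. f x + f' x), ae_class M (\<lambda>x. g x + g' x)) \<in> U"
proof -
  have "(vadd (L2 M) (ae_class M f) (ae_class M f'), vadd (L2 M) (ae_class M g) (ae_class M g')) \<in> U"
    using linear_U assms(1,2) unfolding linear_op_def by blast
  then show ?thesis by (simp add: vadd_L2)
qed

lemma U_diff:
  assumes "(ae_class M f, ae_class M g) \<in> U" "(ae_class M f', ae_class M g') \<in> U"
    and [measurable]: "f \<in> borel_measurable M" "g \<in> borel_measurable M" "f' \<in> borel_measurable M" "g' \<in> borel_measurable M"
  shows "(ae_class M (\<lambda>x. f x - f' x), ae_class M (\<lambda>x. g x - g' x)) \<in> U"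
proof -
  have "(vscale (L2 M) (- 1) (ae_class M f'), vscale (L2 M) (- 1) (ae_class M g')) \<in> U"
    using linear_U assms(2) unfolding linear_op_def by blast
  then have "(vadd (L2 M) (ae_class M f) (vscale (L2 M) (- 1) (ae_class M f')),
      vadd (L2 M) (ae_class M g) (vscale (L2 M) (- 1) (ae_class M g'))) \<in> U"
    using linear_U assms(1) unfolding linear_op_def by blast
  then show ?thesis by (simp add: vdiff_L2)
qed

lemma U_bound:
  obtains c where "0 \<le> c" "\<And>f g. (ae_class M f, ae_class M g) \<in> U \<Longrightarrow> f \<in> borel_measurable M \<Longrightarrow>
    g \<in> borel_measurable M \<Longrightarrow> sqnorm M g \<le> c * sqnorm M f"
proof -
  from bounded_U obtain c where c: "\<forall>(F, G)\<in>U. vnorm (L2 M) G \<le> c * vnorm (L2 M) F"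
    by (auto simp: bounded_op_def)
  have "sqnorm M g \<le> c\<^sup>2 * sqnorm M f"
    if "(ae_class M f, ae_class M g) \<in> U" "f \<in> borel_measurable M" "g \<in> borel_measurable M" for f g
  proof -
    have "sqrt (sqnorm M g) \<le> c * sqrt (sqnorm M f)"
      using c that by (auto simp: vnorm_L2)
    then have "(sqrt (sqnorm M g))\<^sup>2 \<le> (c * sqrt (sqnorm M f))\<^sup>2"
      by (rule power_mono) simp
    then show ?thesis by (simp add: power_mult_distrib)
  qed
  \<comment> \<open>The square provides a nonnegative constant, whatever the sign of c.\<close>
  then show thesis by (intro that[of "c\<^sup>2"]) auto
qed

text \<open>\<open>U\<close> is known on the range of \<open>|C\<^sub>\<phi>|\<close> and on the kernel of \<open>C\<^sub>\<phi>\<close>; the truncations of \<open>g\<close> to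
  \<open>{r = 0} \<union> {r \<ge> 1/n}\<close> lie in the sum of these two and converge to \<open>g\<close>.\<close>

lemma U_eq_polar_map:
  assumes g: "square_integrable M g"
  shows "(ae_class M g, ae_class M (polar_map g)) \<in> U"
proof -
  obtain k where k: "square_integrable M k" "(ae_class M g, ae_class M k) \<in> U"
    using U_value[OF g] .
  note [measurable] = square_integrable_measurable[OF g] square_integrable_measurable[OF k(1)]
    square_integrable_measurable[OF square_integrable_polar_map[OF g]]
  obtain c where c: "0 \<le> c" "\<And>f g. (ae_class M f, ae_class M g) \<in> U \<Longrightarrow> f \<in> borel_measurable M \<Longrightarrow>
    g \<in> borel_measurable M \<Longrightarrow> sqnorm M g \<le> c * sqnorm M f"
    using U_bound by blast
  define z where "z = (\<lambda>x. if r x = 0 then g x else 0)"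
  define g' where "g' = (\<lambda>x. if r x \<noteq> 0 then g x else 0)"
  have z: "square_integrable M z" unfolding z_def by (rule square_integrable_restrict[OF g]) measurable
  have g': "square_integrable M g'" unfolding g'_def by (rule square_integrable_restrict[OF g]) measurable
  note [measurable] = square_integrable_measurable[OF z] square_integrable_measurable[OF g']
  have "ae_class M z \<in> op_kernel (L2 M) U"
    unfolding kernel_U op_kernel_comp_op using z by (auto simp: z_def)
  then have zU: "(ae_class M z, ae_class M (\<lambda>x. 0)) \<in> U" by (simp add: op_kernel_def vzero_L2)
  define e where "e = (\<lambda>n x. g' x - (if 1 \<le> real n * r x then g' x else 0))"
  have e: "square_integrable M (e n)" for n
    unfolding e_def by (intro square_integrable_diff square_integrable_restrict g') measurable
  have D: "square_integrable M (\<lambda>x. k x - polar_map g x)"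
    by (rule square_integrable_diff[OF k(1) square_integrable_polar_map[OF g]])
  \<comment> \<open>Both k and \<open>polar_map g\<close> are compared with the image of the
    truncation: boundedness of U gives c ||e_n||^2, contractivity of \<open>polar_map\<close> gives
    ||e_n||^2, and the sum of two errors costs a factor 2.\<close>
  have bound: "sqnorm M (\<lambda>x. k x - polar_map g x) \<le> (2 * c + 2) * sqnorm M (e n)" for n
  proof -
    define gn where "gn = (\<lambda>x. if 1 \<le> real n * r x then g x else 0)"
    \<comment> \<open>The modulus sends \<open>fn\<close> to \<open>gn\<close> and C sends it to fn
      \<circ> \<phi>; so C = U|C| forces U to send \<open>gn\<close> to fn \<circ> \<phi>.\<close>
    define fn where "fn = (\<lambda>x. gn x / complex_of_real (r x))"
    have gn: "square_integrable M gn" unfolding gn_def by (rule square_integrable_restrict[OF g]) measurable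
    have fN: "square_integrable N fn" unfolding fn_def by (rule square_integrable_divide_r[OF gn])
    have fn_trunc: "fn = (\<lambda>x. if 1 \<le> real n * r x then fn x else 0)"
      by (auto simp: fn_def gn_def)
    have fn: "square_integrable M fn"
      by (subst fn_trunc) (rule square_integrable_lower_truncation[OF fN])
    note [measurable] = square_integrable_measurable[OF gn] square_integrable_measurable[OF fn]
    have rfn: "(\<lambda>x. complex_of_real (r x) * fn x) = gn"
      by (auto simp: fn_def gn_def fun_eq_iff)
    have fphi: "square_integrable M (fn \<circ> \<phi>)" by (rule square_integrable_compI[OF fN])
    have "(ae_class M fn, ae_class M (fn \<circ> \<phi>)) \<in> comp_op M \<phi>"
      using fn fphi by (simp add: comp_op_iff)
    then obtain Y where Y: "(ae_class M fn, Y) \<in> mult_op M (\<lambda>x. complex_of_real (r x))"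
      "(Y, ae_class M (fn \<circ> \<phi>)) \<in> U"
      unfolding comp_op_eq by blast
    from Y(1) have "Y = ae_class M gn" by (simp add: mult_op_iff rfn)
    with Y(2) have gU: "(ae_class M gn, ae_class M (fn \<circ> \<phi>)) \<in> U" by simp
    have sum: "(ae_class M (\<lambda>x. gn x + z x), ae_class M (\<lambda>x. (fn \<circ> \<phi>) x + 0)) \<in> U"
      by (rule U_add[OF gU zU]) measurable
    have en: "e n = (\<lambda>x. g x - (gn x + z x))"
      by (auto simp: e_def gn_def z_def g'_def fun_eq_iff)
    have "(ae_class M (\<lambda>x. g x - (gn x + z x)), ae_class M (\<lambda>x. k x - ((fn \<circ> \<phi>) x + 0))) \<in> U"
      by (rule U_diff[OF k(2) sum]) measurable
    then have 1: "sqnorm M (\<lambda>x. k x - (fn \<circ> \<phi>) x) \<le> c * sqnorm M (e n)"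
      using c(2) by (simp add: en)
    \<comment> \<open>At points where r \<circ> \<phi> = 0 both sides are 0 by the convention for
      division, so this is an equality of functions.\<close>
    have "polar_map (e n) = (\<lambda>x. polar_map g x - (fn \<circ> \<phi>) x)"
      by (auto simp: polar_map_def e_def g'_def fn_def gn_def fun_eq_iff diff_divide_distrib)
    then have 2: "sqnorm M (\<lambda>x. polar_map g x - (fn \<circ> \<phi>) x) \<le> sqnorm M (e n)"
      using sqnorm_polar_map_le[OF e[of n]] by simp
    have "sqnorm M (\<lambda>x. k x - polar_map g x)
        = sqnorm M (\<lambda>x. (k x - (fn \<circ> \<phi>) x) - (polar_map g x - (fn \<circ> \<phi>) x))"
      by simp
    also have "\<dots> \<le> 2 * sqnorm M (\<lambda>x. k x - (fn \<circ> \<phi>) x) + 2 * sqnorm M (\<lambda>x. polar_map g x - (fn \<circ> \<phi>) x)"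
      by (intro sqnorm_diff_le square_integrable_diff k(1) fphi square_integrable_polar_map[OF g])
    also have "\<dots> \<le> 2 * (c * sqnorm M (e n)) + 2 * sqnorm M (e n)"
      using 1 2 by linarith
    finally show ?thesis by (simp add: algebra_simps)
  qed
  have "(\<lambda>n. sqnorm M (e n)) \<longlonglongrightarrow> 0"
    unfolding e_def
  proof (rule sqnorm_truncation_tendsto_0[OF g'])
    show "AE x in M. g' x \<noteq> 0 \<longrightarrow> (\<forall>\<^sub>F n in sequentially. 1 \<le> real n * r x)"
      by (auto simp: g'_def intro: eventually_lower_truncation)
  qed measurable
  from tendsto_mult_left[OF this, of "2 * c + 2"]
  have "sqnorm M (\<lambda>x. k x - polar_map g x) \<le> 0"
    by (intro LIMSEQ_le_const[of "\<lambda>n. (2 * c + 2) * sqnorm M (e n)"]) (use bound in auto)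
  then have "sqnorm M (\<lambda>x. k x - polar_map g x) = 0" by (intro antisym) simp_all
  then have "AE x in M. k x - polar_map g x = 0" by (simp add: sqnorm_eq_0_iff[OF D])
  then have "AE x in M. k x = polar_map g x" by eventually_elim simp
  from ae_class_cong[OF this] k(2) show ?thesis by simp
qed

lemma U_eq: "U = {(ae_class M g, ae_class M (polar_map g)) | g. square_integrable M g}"
proof (intro equalityI subsetI)
  fix p assume p: "p \<in> U"
  obtain F G where FG: "p = (F, G)" by (cases p)
  with p have "F \<in> vecs (L2 M)" using Domain_U by auto
  then obtain g where g: "square_integrable M g" "F = ae_class M g" by (rule vecs_L2E)
  with p FG U_unique[OF U_eq_polar_map[OF g(1)]] 
  show "p \<in> {(ae_class M g, ae_class M (polar_map g)) | g. square_integrable M g}" by blast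
qed (use U_eq_polar_map in blast)

section \<open>The final space and the adjoint of U\<close>

lemma Range_U: "Range U = comp_range"
proof (intro equalityI subsetI)
  fix G assume "G \<in> Range U"
  then obtain g where "square_integrable M g" "G = ae_class M (polar_map g)"
    by (auto simp: U_eq)
  then show "G \<in> comp_range"
    unfolding comp_range_def polar_map_def using square_integrable_divide_r by blast
next
  fix G assume "G \<in> comp_range"
  then obtain f where f: "square_integrable N f" "G = ae_class M (f \<circ> \<phi>)"
    by (auto simp: comp_range_def)
  \<comment> \<open>The preimage of f \<circ> \<phi> is r f: along \<phi> the factor r cancels,
    being nonzero a.e.\<close>
  have "AE x in M. polar_map (\<lambda>x. complex_of_real (r x) * f x) x = (f \<circ> \<phi>) x"
    using r_comp_nonzero by eventually_elim (simp add: polar_map_def)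
  then have "G = ae_class M (polar_map (\<lambda>x. complex_of_real (r x) * f x))"
    unfolding f(2) by (rule ae_class_cong[symmetric])
  then show "G \<in> Range U"
    using U_eq_polar_map[OF square_integrable_weightI[OF f(1)]] by blast
qed

text \<open>U f = V (f / r), so <g, U f> = <w, f / r> in L^2(N). This is the integral of r^2 w cnj
  (f / r) d\<mu>, that is, <r w, f>.\<close>

lemma adjoint_U_mem:
  assumes g: "square_integrable M g" and w: "comp_adjoint g w"
  shows "(ae_class M g, ae_class M (\<lambda>x. complex_of_real (r x) * w x)) \<in> adjoint_op (L2 M) (L2 M) U"
proof -
  from w have wN: "square_integrable N w" by (simp add: comp_adjoint_def)
  note rw = square_integrable_weightI[OF wN]
  note [measurable] = square_integrable_measurable[OF g] square_integrable_h_measure_measurable[OF wN]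
  have "cinner (L2 M) Y (ae_class M g) = cinner (L2 M) X (ae_class M (\<lambda>x. complex_of_real (r x) * w x))"
    if XY: "(X, Y) \<in> U" for X Y
  proof -
    from XY obtain f where f: "square_integrable M f" "X = ae_class M f" "Y = ae_class M (polar_map f)"
      by (auto simp: U_eq)
    note [measurable] = square_integrable_measurable[OF f(1)]
      square_integrable_measurable[OF square_integrable_polar_map[OF f(1)]]
    have "(LINT x|M. g x * cnj (polar_map f x)) = (LINT x|N. w x * cnj (f x / complex_of_real (r x)))"
      using w square_integrable_divide_r[OF f(1)] by (auto simp: comp_adjoint_iff polar_map_def)
    also have "\<dots> = (LINT x|M. complex_of_real ((r x)\<^sup>2) * (w x * cnj (f x / complex_of_real (r x))))"
      by (rule integral_h_measure) measurable
    \<comment> \<open>One factor r cancels the denominator; where r = 0 both integrands are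
      0.\<close>
    also have "\<dots> = (LINT x|M. complex_of_real (r x) * w x * cnj (f x))"
      by (rule Bochner_Integration.integral_cong) (simp_all add: power2_eq_square)
    finally have eq: "(LINT x|M. g x * cnj (polar_map f x)) = (LINT x|M. complex_of_real (r x) * w x * cnj (f x))" .
    have "(LINT x|M. polar_map f x * cnj (g x)) = (LINT x|M. cnj (g x * cnj (polar_map f x)))"
      by (simp add: mult.commute)
    also have "\<dots> = cnj (LINT x|M. g x * cnj (polar_map f x))" by (rule Bochner_Integration.integral_cnj)
    also have "\<dots> = (LINT x|M. cnj (complex_of_real (r x) * w x * cnj (f x)))"
      unfolding eq by (rule Bochner_Integration.integral_cnj[symmetric])
    also have "\<dots> = (LINT x|M. f x * cnj (complex_of_real (r x) * w x))"
      by (simp add: mult.commute mult.left_commute)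
    finally show ?thesis unfolding f by (simp add: cinner_L2)
  qed
  with ae_class_in_vecs[OF g] ae_class_in_vecs[OF rw] show ?thesis
    unfolding adjoint_op_def by blast
qed

text \<open>U is defined everywhere, so the difference of two candidates may be tested against
  itself.\<close>

lemma adjoint_U_unique:
  assumes K: "(G, K) \<in> adjoint_op (L2 M) (L2 M) U" and K': "(G, K') \<in> adjoint_op (L2 M) (L2 M) U"
  shows "K = K'"
proof -
  from K K' obtain k k' where k: "square_integrable M k" "K = ae_class M k"
    and k': "square_integrable M k'" "K' = ae_class M k'"
    by (auto simp: adjoint_op_def elim!: vecs_L2E)
  note [measurable] = square_integrable_measurable[OF k(1)] square_integrable_measurable[OF k'(1)]
  define d where "d = (\<lambda>x. k x - k' x)"
  have d: "square_integrable M d" unfolding d_def by (rule square_integrable_diff[OF k(1) k'(1)])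
  note [measurable] = square_integrable_measurable[OF d]
  obtain Y where Y: "(ae_class M d, Y) \<in> U" using U_value[OF d] by blast
  have "cinner (L2 M) Y G = cinner (L2 M) (ae_class M d) K"
    using K Y by (auto simp: adjoint_op_def)
  moreover have "cinner (L2 M) Y G = cinner (L2 M) (ae_class M d) K'"
    using K' Y by (auto simp: adjoint_op_def)
  ultimately have "cinner (L2 M) (ae_class M d) K = cinner (L2 M) (ae_class M d) K'" by simp
  then have "(LINT x|M. d x * cnj (k x)) = (LINT x|M. d x * cnj (k' x))"
    by (simp add: k k' cinner_L2)
  then have "(LINT x|M. d x * cnj (k x) - d x * cnj (k' x)) = 0"
    using integrable_mult_cnj[OF d k(1)] integrable_mult_cnj[OF d k'(1)] by simp
  then have "complex_of_real (sqnorm M d) = 0"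
    by (simp add: integral_mult_cnj_self[symmetric] d_def right_diff_distrib)
  then have "AE x in M. d x = 0" using sqnorm_eq_0_iff[OF d] by simp
  then have "AE x in M. k x = k' x" by eventually_elim (simp add: d_def)
  then show ?thesis unfolding k(2) k'(2) by (rule ae_class_cong)
qed

lemma adjoint_U_eq:
  "adjoint_op (L2 M) (L2 M) U
    = {(ae_class M g, ae_class M (\<lambda>x. complex_of_real (r x) * w x)) | g w. square_integrable M g \<and> comp_adjoint g w}"
proof (intro equalityI subsetI)
  fix p assume p: "p \<in> adjoint_op (L2 M) (L2 M) U"
  obtain G K where GK: "p = (G, K)" by (cases p)
  with p obtain g where g: "square_integrable M g" "G = ae_class M g"
    by (auto simp: adjoint_op_def elim: vecs_L2E)
  obtain w where w: "comp_adjoint g w" using comp_adjoint_exists[OF g(1)] by blast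
  have "K = ae_class M (\<lambda>x. complex_of_real (r x) * w x)"
    by (rule adjoint_U_unique[OF _ adjoint_U_mem[OF g(1) w]]) (use p GK g(2) in simp)
  with GK g w show "p \<in> {(ae_class M g, ae_class M (\<lambda>x. complex_of_real (r x) * w x)) | g w. square_integrable M g \<and> comp_adjoint g w}"
    by blast
qed (use adjoint_U_mem in blast)

lemma Domain_adjoint_U: "Domain (adjoint_op (L2 M) (L2 M) U) = vecs (L2 M)"
proof (intro equalityI subsetI)
  fix G assume "G \<in> vecs (L2 M)"
  then obtain g where g: "square_integrable M g" "G = ae_class M g" by (rule vecs_L2E)
  obtain w where "comp_adjoint g w" using comp_adjoint_exists[OF g(1)] by blast
  from adjoint_U_mem[OF g(1) this] g(2) show "G \<in> Domain (adjoint_op (L2 M) (L2 M) U)" by blast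
qed (auto simp: adjoint_op_def)

text \<open>A representative \<open>w\<close> is determined only up to null sets of N. Such a set
  can have \<mu>-mass only where r = 0, so r w is determined \<mu>-a.e. and every choice gives the
  same class.\<close>

lemma adjoint_U_eq_projection:
  "adjoint_op (L2 M) (L2 M) U
    = {(G, ae_class M (\<lambda>x. complex_of_real (r x) * w x)) | G F w.
        (G, F) \<in> orth_projection (L2 M) comp_range O (comp_unitary M \<phi>)\<inverse> \<and> w \<in> F}"
  unfolding adjoint_U_eq projection_comp_unitary_iff by blast

end

theorem proposition7p1:
  fixes M :: "'a measure" and \<phi> :: "'a \<Rightarrow> 'a"
    and U :: "(('a \<Rightarrow> complex) set \<times> ('a \<Rightarrow> complex) set) set"
  assumes "sigma_finite_measure M"
    and "nonsingular M \<phi>"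
    and "densely_defined (L2 M) (comp_op M \<phi>)"
    and "polar_decomposition (L2 M) (L2 M) (comp_op M \<phi>) U"
  shows
    "abs_op (L2 M) (L2 M) (comp_op M \<phi>) = mult_op M (sqrt_h M \<phi>)
     \<and>
     (initial_space (L2 M) (L2 M) U
        = vclosure (L2 M) (Range (abs_op (L2 M) (L2 M) (comp_op M \<phi>))) \<and>
      vclosure (L2 M) (Range (abs_op (L2 M) (L2 M) (comp_op M \<phi>)))
        = {ae_class M (\<lambda>x. sqrt_h M \<phi> x * f x) | f. square_integrable (h_measure M \<phi>) f})
     \<and>
     (final_space U = vclosure (L2 M) (Range (comp_op M \<phi>)) \<and>
      vclosure (L2 M) (Range (comp_op M \<phi>))
        = {ae_class M (f \<circ> \<phi>) | f. square_integrable (h_measure M \<phi>) f})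
     \<and>
     U = {(ae_class M g, ae_class M (\<lambda>x. g (\<phi> x) / sqrt_h M \<phi> (\<phi> x))) | g.
            square_integrable M g}
     \<and>
     (unitary_op (L2 (h_measure M \<phi>))
        ((L2 M)\<lparr>vecs := vclosure (L2 M) (Range (comp_op M \<phi>))\<rparr>) (comp_unitary M \<phi>) \<and>
      Domain (adjoint_op (L2 M) (L2 M) U) = vecs (L2 M) \<and>
      adjoint_op (L2 M) (L2 M) U
        = {(G, ae_class M (\<lambda>x. sqrt_h M \<phi> x * f x)) | G F f.
             (G, F) \<in> orth_projection (L2 M) (vclosure (L2 M) (Range (comp_op M \<phi>)))
                        O (comp_unitary M \<phi>)\<inverse> \<and> f \<in> F})"
proof -
  interpret sigma_finite_measure M by (rule assms(1))
  interpret polar_composition M \<phi> U by unfold_locales (use assms in auto)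
  have "initial_space (L2 M) (L2 M) U = weighted_range"
    by (simp add: initial_space_def kernel_U orth_compl_kernel)
  moreover have "U = {(ae_class M g, ae_class M (\<lambda>x. g (\<phi> x) / complex_of_real (r (\<phi> x)))) | g.
      square_integrable M g}"
    unfolding U_eq by (simp add: polar_map_def o_def)
  ultimately show ?thesis
    unfolding abs_comp_op sqrt_h_eq closure_range_abs closure_comp_range
    using unitary_comp_unitary Domain_adjoint_U adjoint_U_eq_projection Range_U
    by (intro conjI) (simp_all add: final_space_def weighted_range_def comp_range_def)
qed

end
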